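(* Suppose that $$0<\liminf_{n\to\infty}\alpha_n,\qquad \limsup_{n\to\infty}(1-\beta_n)<1,\qquad \limsup_{n\to\infty}\alpha_n<\liminf_{n\to\infty}(1-\beta_n).$$ In addition, assume that there exists $\varepsilon>0$ such that for each $t\in\mathbb{R}$ $$G_n(t)=O\bigl((\log n)^{-(1+\varepsilon)}\bigr),\qquad H_n(t)=O\bigl((\log n)^{-(1+\varepsilon)}\bigr),$$ as $n\to\infty$. Then, for each $c>0$ and $A>0$, $$\mathbf{P}\Bigl(\frac{\sqrt{n}(T_n-\mu_n)}{\sigma_{W,n}}>x\Bigr)=[1-\Phi(x)](1+o(1)),$$ $$\mathbf{P}\Bigl(\frac{\sqrt{n}(T_n-\mu_n)}{\sigma_{W,n}}<-x\Bigr)=\Phi(-x)(1+o(1)),$$ as $n\to\infty$, uniformly in the range $-A\le x\le c\sqrt{\log n}$.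
   Context: Let $X_1,X_2,\dots$ be i.i.d. real-valued random variables with common distribution function $F$, and for each $n\ge1$ let $X_{1:n}\le\dots\le X_{n:n}$ be the order statistics of $X_1,\dots,X_n$. Let $F^{-1}(u)=\inf\{x:F(x)\ge u\}$ for $0<u\le1$, $F^{-1}(0)=F^{-1}(0^+)$, be the left-continuous inverse, and write $\xi_\nu=F^{-1}(\nu)$ for $0<\nu<1$. $\Phi$ is the standard normal distribution function. Let $k_n,m_n$ be integer sequences with $0\le k_n<n-m_n\le n$, and put $\alpha_n=k_n/n$, $\beta_n=m_n/n$. Standing assumption: $\min(k_n,m_n)\to\infty$ as $n\to\infty$. The trimmed mean is $T_n=\frac1n\sum_{i=k_n+1}^{n-m_n}X_{i:n}$ (note the normalization by $n$). Let $W_i^{(n)}$, $i=1,\dots,n$, be $X_i$ Winsorized outside $(\xi_{\alpha_n},\xi_{1-\beta_n}]$: $W_i^{(n)}=\xi_{\alpha_n}$ if $X_i\le\xi_{\alpha_n}$; $W_i^{(n)}=X_i$ if $\xi_{\alpha_n}<X_i\le\xi_{1-\beta_n}$; $W_i^{(n)}=\xi_{1-\beta_n}$ if $X_i>\xi_{1-\beta_n}$. Normalizing sequences: $\mu_n=\int_{\alpha_n}^{1-\beta_n}F^{-1}(s)\,ds$ and $\sigma_{W,n}=\bigl(\mathrm{Var}(W_1^{(n)})\bigr)^{1/2}$. Standing assumption: $\liminf_{n\to\infty}\sigma_{W,n}>0$. Auxiliary functions, for $t\in\mathbb{R}$ (for fixed $t$ well-defined for all sufficiently large $n$ under the stated conditions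 on $\alpha_n,\beta_n$): $$G_n(t)=F^{-1}\Bigl(\alpha_n+t\sqrt{\tfrac{\alpha_n\log n}{n}}\Bigr)-F^{-1}(\alpha_n),\qquad H_n(t)=F^{-1}\Bigl(1-\beta_n+t\sqrt{\tfrac{\beta_n\log n}{n}}\Bigr)-F^{-1}(1-\beta_n).$$ *)

theory Defs
  imports "HOL-Probability.Probability" "HOL-Library.Landau_Symbols"
begin

text \<open>
  Left-continuous inverse of a distribution function. It is real valued, so it is meaningful for
  \<open>0 < u < 1\<close>, and at \<open>u = 0\<close> and \<open>u = 1\<close> only if the mathematical value is finite there. In the
  asymptotic statements below, all arguments eventually lie strictly between 0 and 1.
\<close>
definition quantile :: "(real \<Rightarrow> real) \<Rightarrow> real \<Rightarrow> real" where
  "quantile F u =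
     (if u = 0 then Lim (at_right 0) (\<lambda>v. Inf {x. v \<le> F x}) else Inf {x. u \<le> F x})"

text \<open>The sample of size \<open>n\<close> is \<open>X 1, \<dots>, X n\<close>; the \<open>i\<close>-th smallest value is meaningful for
  \<open>1 \<le> i \<le> n\<close>.\<close>
definition order_stat :: "(nat \<Rightarrow> 'a \<Rightarrow> real) \<Rightarrow> nat \<Rightarrow> nat \<Rightarrow> 'a \<Rightarrow> real" where
  "order_stat X n i \<omega> = sort (map (\<lambda>j. X j \<omega>) [1..<Suc n]) ! (i - 1)"

text \<open>The normalization is by \<open>n\<close>, not by the number of summands.\<close>
definition trimmed_mean :: "(nat \<Rightarrow> 'a \<Rightarrow> real) \<Rightarrow> nat \<Rightarrow> nat \<Rightarrow> nat \<Rightarrow> 'a \<Rightarrow> real" where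
  "trimmed_mean X k m n \<omega> = (\<Sum>i = k + 1..n - m. order_stat X n i \<omega>) / real n"

definition winsorize :: "real \<Rightarrow> real \<Rightarrow> real \<Rightarrow> real" where
  "winsorize a b x = (if x \<le> a then a else if x \<le> b then x else b)"

definition trimmed_center :: "(real \<Rightarrow> real) \<Rightarrow> real \<Rightarrow> real \<Rightarrow> real" where
  "trimmed_center F \<alpha> \<beta> = (LINT s:{\<alpha>..1 - \<beta>}|lborel. quantile F s)"

definition winsorized_sd ::
    "'a measure \<Rightarrow> ('a \<Rightarrow> real) \<Rightarrow> (real \<Rightarrow> real) \<Rightarrow> real \<Rightarrow> real \<Rightarrow> real" where
  "winsorized_sd M Y F \<alpha> \<beta> =
     sqrt (prob_space.variance M
       (\<lambda>\<omega>. winsorize (quantile F \<alpha>) (quantile F (1 - \<beta>)) (Y \<omega>)))"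

definition G_aux :: "(real \<Rightarrow> real) \<Rightarrow> (nat \<Rightarrow> real) \<Rightarrow> real \<Rightarrow> nat \<Rightarrow> real" where
  "G_aux F \<alpha> t n =
     quantile F (\<alpha> n + t * sqrt (\<alpha> n * ln (real n) / real n)) - quantile F (\<alpha> n)"

definition H_aux :: "(real \<Rightarrow> real) \<Rightarrow> (nat \<Rightarrow> real) \<Rightarrow> real \<Rightarrow> nat \<Rightarrow> real" where
  "H_aux F \<beta> t n =
     quantile F (1 - \<beta> n + t * sqrt (\<beta> n * ln (real n) / real n)) - quantile F (1 - \<beta> n)"

definition std_normal_cdf :: "real \<Rightarrow> real" where
  "std_normal_cdf = cdf std_normal_distribution"

text \<open>\<open>p n x = q n x * (1 + o(1))\<close> as \<open>n\<close> tends to infinity, uniformly for \<open>x\<close> in the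
  \<open>n\<close>-dependent range \<open>R n\<close>.\<close>
definition unif_rel_equiv ::
    "(nat \<Rightarrow> real \<Rightarrow> real) \<Rightarrow> (nat \<Rightarrow> real \<Rightarrow> real) \<Rightarrow> (nat \<Rightarrow> real set) \<Rightarrow> bool" where
  "unif_rel_equiv p q R \<longleftrightarrow>
     (\<exists>r. (\<forall>\<^sub>F n in sequentially. \<forall>x\<in>R n. p n x = q n x * (1 + r n x)) \<and>
          (\<forall>\<delta>>0. \<forall>\<^sub>F n in sequentially. \<forall>x\<in>R n. \<bar>r n x\<bar> < \<delta>))"

end

theory Submission
  imports Defs "HOL-Real_Asymp.Real_Asymp"
begin

text \<open>
  Up to a remainder, \<open>T\<^sub>n - \<mu>\<^sub>n\<close> is the mean of the centred Winsorized variables. The remainder is the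
  difference of two trimming gaps; by Hoeffding's inequality for the counts of observations below
  the quantiles at \<open>p\<close> and \<open>p \<plusminus> t * sqrt (p * ln n / n)\<close> and the smoothness of the quantile function,
  \<open>sqrt n\<close> times the remainder is \<open>O((ln n) powr (- 1 / 2 - \<epsilon>))\<close> outside an event whose probability
  decays faster than any prescribed power of \<open>n\<close>. This is negligible against \<open>1 / x\<close>, and so does
  not change the normal tail at \<open>x \<le> c * sqrt (ln n)\<close>.

  The moderate deviations of the i.i.d. bounded sum need neither exponential tilting nor
  characteristic functions. In Lindeberg's replacement of the summands by Gaussians, tested against a
  smoothed indicator of \<open>[a, \<infinity>)\<close> at scale \<open>\<delta> = n powr (- 1 / 12)\<close>, the third order errors are supported
  near \<open>[a, \<infinity>)\<close>, hence bounded by the tails of the hybrid sums themselves times \<open>O(n powr (- 1 / 4))\<close>.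
  Iterating this inequality finitely often turns it into an estimate with relative error \<open>o(1)\<close> and an
  absolute error of arbitrarily high polynomial order.
\<close>

section \<open>A smoothed indicator with cubic Taylor remainder\<close>

text \<open>At \<open>x = c * sqrt (ln n)\<close> the normal tail is roughly n^(-c^2/2), so for
  large c an absolute error of Berry-Esseen order n^(-1/2) says nothing. Errors are therefore kept
  apart by kind: relative ones need only tend to 0; a shift of the argument by h changes the tail at
  x by a factor 1 + O(h (1 + |x|)), so h must be o(1 / sqrt(ln n)); absolute ones must beat
  n^(-(c^2/2 + 1)). The number of rounds, the order of the Gaussian moment and the \<open>t\<close>
  put into \<open>G_aux\<close> and \<open>H_aux\<close> are chosen from c by the last requirement,
  which is how smoothness for arbitrary \<open>t\<close> enters.

  The distribution function F may have atoms. Order statistics are therefore handled by counts on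
  closed and open half-lines instead of through F(F^{-1}(p)) = p, which may fail.

  The test function is the distribution function of a sum of three independent uniform variables on
  [0, 1]: its second derivative is Lipschitz, and its form as a combination of truncated cubes lets
  the Taylor estimate be checked by algebra.\<close>

definition smooth_step :: "real \<Rightarrow> real" where
  "smooth_step u =
     (max 0 u ^ 3 - 3 * max 0 (u - 1) ^ 3 + 3 * max 0 (u - 2) ^ 3 - max 0 (u - 3) ^ 3) / 6"

lemma smooth_step_eq_0: "u \<le> 0 \<Longrightarrow> smooth_step u = 0"
  by (simp add: smooth_step_def)

lemma smooth_step_eq_1: "3 \<le> u \<Longrightarrow> smooth_step u = 1"
  by (simp add: smooth_step_def max_def power3_eq_cube algebra_simps)

lemma smooth_step_range: "0 \<le> smooth_step u" "smooth_step u \<le> 1"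
proof -
  consider "u \<le> 0" | "0 \<le> u" "u \<le> 1" | "1 \<le> u" "u \<le> 2" | "2 \<le> u" "u \<le> 3" | "3 \<le> u"
    by linarith
  then have "0 \<le> smooth_step u \<and> smooth_step u \<le> 1"
  proof cases
    case 2
    then have "u ^ 3 \<le> 1" by (simp add: power_le_one)
    with 2 show ?thesis by (simp add: smooth_step_def)
  next
    case 3
    define v where "v = u - 1"
    have v: "0 \<le> v" "v \<le> 1" "u = 1 + v" using 3 by (auto simp: v_def)
    have "v ^ 2 \<le> v" "v ^ 3 \<le> v ^ 2" "0 \<le> v ^ 3"
      using v power_decreasing[of 1 2 v] power_decreasing[of 2 3 v] by auto
    moreover have "smooth_step u = (1 + 3 * v + 3 * v ^ 2 - 2 * v ^ 3) / 6"
      using v by (simp add: smooth_step_def power3_eq_cube power2_eq_square algebra_simps)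
    moreover have "3 * v + 3 * v ^ 2 - 2 * v ^ 3 \<le> 5"
    proof -
      have "0 \<le> (1 - v) * (4 + v - 2 * v\<^sup>2)"
        using v \<open>v ^ 2 \<le> v\<close> by (intro mult_nonneg_nonneg) auto
      then show ?thesis
        by (simp add: power3_eq_cube power2_eq_square algebra_simps)
    qed
    ultimately show ?thesis
      using v zero_le_power2[of v] by (intro conjI) (simp_all only: divide_le_eq_1 zero_le_divide_iff, linarith+)
  next
    case 4
    have "(3 - u) ^ 3 \<le> 1" "0 \<le> (3 - u) ^ 3" using 4 by (simp_all add: power_le_one)
    moreover have "smooth_step u = 1 - (3 - u) ^ 3 / 6"
      using 4 by (simp add: smooth_step_def power3_eq_cube field_simps)
    ultimately show ?thesis by auto
  qed (simp_all add: smooth_step_eq_0 smooth_step_eq_1)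
  then show "0 \<le> smooth_step u" "smooth_step u \<le> 1" by auto
qed

lemma smooth_step_measurable [measurable]: "smooth_step \<in> borel_measurable borel"
  unfolding smooth_step_def[abs_def] by measurable

text \<open>The second derivative of the truncated cube is Lipschitz with constant 6, which leaves
  \<open>\<bar>y\<bar> ^ 3\<close> after division by 3!. Nothing remains when both ends are
  negative; the cruder condition \<open>0 \<le> s + \<bar>y\<bar>\<close> involves only the size of
  \<open>y\<close>, which suits the later split at size \<delta>.\<close>

lemma cubic_remainder:
  fixes s y :: real
  shows "\<bar>max 0 (s + y) ^ 3 - max 0 s ^ 3 - 3 * max 0 s ^ 2 * y - 3 * max 0 s * y ^ 2\<bar>
    \<le> (if 0 \<le> s + \<bar>y\<bar> then \<bar>y\<bar> ^ 3 else 0)"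
proof -
  consider "0 \<le> s" "0 \<le> s + y" | "0 \<le> s" "s + y < 0" | "s < 0" "0 \<le> s + y" | "s < 0" "s + y < 0"
    by linarith
  then show ?thesis
  proof cases
    case 1
    then have "max 0 (s + y) ^ 3 - max 0 s ^ 3 - 3 * max 0 s ^ 2 * y - 3 * max 0 s * y ^ 2 = y ^ 3"
      by (simp add: power3_eq_cube power2_eq_square algebra_simps)
    with 1 show ?thesis by (simp add: power_abs)
  next
    case 2
    define w where "w = - (s + y)"
    have eq: "max 0 (s + y) ^ 3 - max 0 s ^ 3 - 3 * max 0 s ^ 2 * y - 3 * max 0 s * y ^ 2
      = - ((- y) ^ 3 - w ^ 3)"
      using 2 by (simp add: w_def power3_eq_cube power2_eq_square algebra_simps)
    have "0 \<le> w" "w \<le> - y" using 2 by (auto simp: w_def)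
    then have "0 \<le> w ^ 3" "w ^ 3 \<le> (- y) ^ 3" by (simp, intro power_mono)
    moreover have "\<bar>y\<bar> = - y" using 2 by simp
    ultimately show ?thesis using 2 unfolding eq by (simp del: power_minus_odd)
  next
    case 3
    then have "(s + y) ^ 3 \<le> y ^ 3" "0 \<le> (s + y) ^ 3" by (auto intro!: power_mono)
    then show ?thesis using 3 by simp
  next
    case 4
    then show ?thesis by auto
  qed
qed

text \<open>The coefficients are left existential: they will cancel between two laws with equal mean
  and variance, so all that matters is that they do not depend on \<open>y\<close>.\<close>

lemma smooth_step_taylor:
  fixes s :: real
  shows "\<exists>c1 c2. \<forall>y.
    \<bar>smooth_step (s + y) - smooth_step s - c1 * y - c2 * y ^ 2\<bar>
       \<le> (if 0 \<le> s + \<bar>y\<bar> then 4 / 3 * \<bar>y\<bar> ^ 3 else 0)"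
proof -
  define R where "R s y = max 0 (s + y) ^ 3 - max 0 s ^ 3 - 3 * max 0 s ^ 2 * y - 3 * max 0 s * y ^ 2"
    for s y :: real
  define e where "e y = (if 0 \<le> s + \<bar>y\<bar> then \<bar>y\<bar> ^ 3 else 0)" for y
  \<comment> \<open>Moving a knot to the right only shrinks the region where the remainder lives, so
    one bound \<open>e\<close> serves all four knots. The weights 1, 3, 3, 1 over 6 add up to 4 /
    3.\<close>
  have R: "\<bar>R (s - d) y\<bar> \<le> e y" if "0 \<le> d" for d y
    using order_trans[OF cubic_remainder[of "s - d" y, folded R_def], of "e y"] that
    by (auto simp: e_def split: if_splits)
  define c1 where "c1 = (max 0 s ^ 2 - 3 * max 0 (s-1) ^ 2 + 3 * max 0 (s-2) ^ 2 - max 0 (s-3) ^ 2) / 2"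
  define c2 where "c2 = (max 0 s - 3 * max 0 (s-1) + 3 * max 0 (s-2) - max 0 (s-3)) / 2"
  have "\<bar>smooth_step (s + y) - smooth_step s - c1 * y - c2 * y ^ 2\<bar> \<le> 4 / 3 * e y" for y
  proof -
    have "smooth_step (s + y) - smooth_step s - c1 * y - c2 * y ^ 2 =
      (R s y - 3 * R (s - 1) y + 3 * R (s - 2) y - R (s - 3) y) / 6"
      unfolding smooth_step_def c1_def c2_def R_def by (simp add: algebra_simps add_divide_distrib diff_divide_distrib)
    also have "\<bar>\<dots>\<bar> \<le> 4 / 3 * e y"
      using R[of 0 y] R[of 1 y] R[of 2 y] R[of 3 y] by simp
    finally show ?thesis .
  qed
  moreover have "4 / 3 * e y = (if 0 \<le> s + \<bar>y\<bar> then 4 / 3 * \<bar>y\<bar> ^ 3 else 0)" for y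
    by (simp add: e_def)
  ultimately show ?thesis by (intro exI[of _ c1] exI[of _ c2]) simp
qed

section \<open>Lindeberg replacement for convolutions\<close>

lemma integral_convolution:
  fixes f :: "real \<Rightarrow> real"
  assumes "real_distribution D" "real_distribution \<rho>"
    and f [measurable]: "f \<in> borel_measurable borel" and bd: "\<And>x. \<bar>f x\<bar> \<le> B"
  shows "(\<integral>x. f x \<partial>(D \<star> \<rho>)) = (\<integral>s. (\<integral>y. f (s + y) \<partial>D) \<partial>\<rho>)"
proof -
  interpret D: real_distribution D by fact
  interpret R: real_distribution \<rho> by fact
  interpret pair_prob_space D \<rho> ..
  have "(\<integral>x. f x \<partial>(D \<star> \<rho>)) = (\<integral>z. f (fst z + snd z) \<partial>(D \<Otimes>\<^sub>M \<rho>))"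
    unfolding convolution_def by (subst integral_distr) (auto simp: case_prod_beta)
  also have "\<dots> = (\<integral>s. (\<integral>y. f (y + s) \<partial>D) \<partial>\<rho>)"
    using integral_snd[of "\<lambda>y s. f (y + s)"]
    by (simp add: case_prod_beta' integrable_const_bound[where B=B] bd)
  finally show ?thesis by (simp add: add.commute)
qed

lemma real_distribution_convolution:
  assumes "real_distribution D" "real_distribution \<rho>"
  shows "real_distribution (D \<star> \<rho>)"
proof -
  interpret D: real_distribution D by fact
  interpret R: real_distribution \<rho> by fact
  interpret pair_prob_space D \<rho> ..
  show ?thesis
    unfolding convolution_def real_distribution_def real_distribution_axioms_def
    by (auto intro!: prob_space_distr)
qed

lemma (in finite_measure) integrable_lower_power:
  fixes f :: "'a \<Rightarrow> real"
  assumes [measurable]: "f \<in> borel_measurable M"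
    and "integrable M (\<lambda>x. \<bar>f x\<bar> ^ k)" "j \<le> k"
  shows "integrable M (\<lambda>x. f x ^ j)"
proof (rule Bochner_Integration.integrable_bound[of _ "\<lambda>x. 1 + \<bar>f x\<bar> ^ k"])
  have "\<bar>t\<bar> ^ j \<le> 1 + \<bar>t\<bar> ^ k" for t :: real
  proof (cases "\<bar>t\<bar> \<le> 1")
    case True
    then have "\<bar>t\<bar> ^ j \<le> 1" by (simp add: power_le_one)
    then show ?thesis using zero_le_power[of "\<bar>t\<bar>" k] by linarith
  next
    case False
    then have "\<bar>t\<bar> ^ j \<le> \<bar>t\<bar> ^ k" using assms(3) by (intro power_increasing) auto
    then show ?thesis by linarith
  qed
  then show "AE x in M. norm (f x ^ j) \<le> norm (1 + \<bar>f x\<bar> ^ k)"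
    by (simp add: power_abs abs_of_nonneg)
qed (use assms in auto)

text \<open>The constant is chosen before the law, so that one \<open>c\<close> serves both the
  summand and its Gaussian substitute. The two error terms come from a dichotomy: a jump from
  \<open>s\<close> that reaches \<open>a\<close> either starts within \<delta> of it or is longer
  than \<delta>.\<close>

lemma smooth_step_expectation_taylor:
  assumes \<delta>: "0 < \<delta>"
  shows "\<exists>c. \<forall>\<mu>. real_distribution \<mu> \<longrightarrow> integrable \<mu> (\<lambda>y. \<bar>y\<bar> ^ 3) \<longrightarrow> (\<integral>y. y \<partial>\<mu>) = 0 \<longrightarrow>
     \<bar>(\<integral>y. smooth_step ((s + y - a) / \<delta>) \<partial>\<mu>) - smooth_step ((s - a) / \<delta>) - c * (\<integral>y. y ^ 2 \<partial>\<mu>)\<bar>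
     \<le> 4 / 3 / \<delta> ^ 3 *
        ((\<integral>y. \<bar>y\<bar> ^ 3 \<partial>\<mu>) * indicator {a - \<delta>..} s + (\<integral>y. \<bar>y\<bar> ^ 3 * indicator {y. \<delta> < \<bar>y\<bar>} y \<partial>\<mu>))"
proof -
  obtain c1 c2 where c: "\<forall>y. \<bar>smooth_step ((s - a) / \<delta> + y) - smooth_step ((s - a) / \<delta>) - c1 * y - c2 * y ^ 2\<bar>
       \<le> (if 0 \<le> (s - a) / \<delta> + \<bar>y\<bar> then 4 / 3 * \<bar>y\<bar> ^ 3 else 0)"
    using smooth_step_taylor[of "(s - a) / \<delta>"] by (elim exE) (rule that)
  show ?thesis
  proof (intro exI[of _ "c2 / \<delta> ^ 2"] allI impI)
    fix \<mu> :: "real measure"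
    assume "real_distribution \<mu>" and i3: "integrable \<mu> (\<lambda>y. \<bar>y\<bar> ^ 3)" and m: "(\<integral>y. y \<partial>\<mu>) = 0"
    interpret real_distribution \<mu> by fact
    let ?b = "\<lambda>y. 4 / 3 / \<delta> ^ 3 * (\<bar>y\<bar> ^ 3 * indicator {a - \<delta>..} s + \<bar>y\<bar> ^ 3 * indicator {y. \<delta> < \<bar>y\<bar>} y)"
    let ?r = "\<lambda>y. smooth_step ((s + y - a) / \<delta>) - smooth_step ((s - a) / \<delta>) - c1 / \<delta> * y - c2 / \<delta> ^ 2 * y ^ 2"
    have lower: "integrable \<mu> (\<lambda>y. y ^ j)" if "j \<le> 3" for j
      by (rule integrable_lower_power[where k=3, OF _ i3 that]) simp
    have i1: "integrable \<mu> (\<lambda>y. y)" and i2: "integrable \<mu> (\<lambda>y. y ^ 2)"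
      using lower[of 1] lower[of 2] by simp_all
    have i4: "integrable \<mu> (\<lambda>y. \<bar>y\<bar> ^ 3 * indicator {y. \<delta> < \<bar>y\<bar>} y)"
      by (rule integrable_real_mult_indicator[OF _ i3]) simp
    have i0: "integrable \<mu> (\<lambda>y. smooth_step ((s + y - a) / \<delta>))"
      by (rule integrable_const_bound[of _ 1]) (auto simp: smooth_step_range)
    have pw: "\<bar>?r y\<bar> \<le> ?b y" for y
    proof -
      have e: "(s - a) / \<delta> + y / \<delta> = (s + y - a) / \<delta>" "\<bar>y / \<delta>\<bar> = \<bar>y\<bar> / \<delta>"
        using \<delta> by (simp_all add: diff_divide_distrib add_divide_distrib)
      have "\<bar>?r y\<bar> \<le> (if 0 \<le> (s - a) / \<delta> + \<bar>y\<bar> / \<delta> then 4 / 3 * (\<bar>y\<bar> / \<delta>) ^ 3 else 0)"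
        using c[rule_format, of "y / \<delta>"] unfolding e by (simp add: power_divide)
      also have "\<dots> \<le> ?b y"
      proof (cases "0 \<le> (s - a) / \<delta> + \<bar>y\<bar> / \<delta>")
        case True
        then have "a - \<bar>y\<bar> \<le> s" using \<delta> by (simp add: field_simps)
        then have "1 \<le> (indicator {a - \<delta>..} s :: real) + indicator {y. \<delta> < \<bar>y\<bar>} y"
          by (auto split: split_indicator)
        then have "4 / 3 / \<delta> ^ 3 * \<bar>y\<bar> ^ 3 * 1 \<le> 4 / 3 / \<delta> ^ 3 * \<bar>y\<bar> ^ 3 * (indicator {a - \<delta>..} s + indicator {y. \<delta> < \<bar>y\<bar>} y)"
          using \<delta> by (intro mult_left_mono) auto
        then show ?thesis using True by (simp add: power_divide distrib_left mult.assoc)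
      qed (use \<delta> in auto)
      finally show ?thesis .
    qed
    have "\<bar>\<integral>y. ?r y \<partial>\<mu>\<bar> \<le> (\<integral>y. ?b y \<partial>\<mu>)"
    proof (rule order_trans[OF integral_abs_bound integral_mono])
      show "integrable \<mu> (\<lambda>y. \<bar>?r y\<bar>)" using i0 i1 i2 by auto
      show "integrable \<mu> ?b" using i3 i4 by auto
    qed (rule pw)
    moreover have "(\<integral>y. ?b y \<partial>\<mu>) = 4 / 3 / \<delta> ^ 3 *
        ((\<integral>y. \<bar>y\<bar> ^ 3 \<partial>\<mu>) * indicator {a - \<delta>..} s + (\<integral>y. \<bar>y\<bar> ^ 3 * indicator {y. \<delta> < \<bar>y\<bar>} y \<partial>\<mu>))"
      using i3 i4 by simp
    moreover have "(\<integral>y. ?r y \<partial>\<mu>) =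
        (\<integral>y. smooth_step ((s + y - a) / \<delta>) \<partial>\<mu>) - smooth_step ((s - a) / \<delta>) - c2 / \<delta> ^ 2 * (\<integral>y. y ^ 2 \<partial>\<mu>)"
      using i0 i1 i2 m prob_space by simp
    ultimately show "\<bar>(\<integral>y. smooth_step ((s + y - a) / \<delta>) \<partial>\<mu>) - smooth_step ((s - a) / \<delta>) - c2 / \<delta> ^ 2 * (\<integral>y. y ^ 2 \<partial>\<mu>)\<bar>
     \<le> 4 / 3 / \<delta> ^ 3 *
        ((\<integral>y. \<bar>y\<bar> ^ 3 \<partial>\<mu>) * indicator {a - \<delta>..} s + (\<integral>y. \<bar>y\<bar> ^ 3 * indicator {y. \<delta> < \<bar>y\<bar>} y \<partial>\<mu>))"
      by (simp only:)
  qed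
qed

text \<open>The error is expressed through a tail of the convolution itself, not of the remaining
  sum \<rho>. This is what closes the later recursion over hybrid sums.\<close>

lemma lindeberg_step:
  assumes D: "real_distribution D" and G: "real_distribution G" and R: "real_distribution \<rho>"
    and \<delta>: "0 < \<delta>" and bd: "AE y in D. \<bar>y\<bar> \<le> \<delta>"
    and iG: "integrable G (\<lambda>y. \<bar>y\<bar> ^ 3)"
    and mean: "(\<integral>y. y \<partial>D) = 0" "(\<integral>y. y \<partial>G) = 0"
    and var: "(\<integral>y. y ^ 2 \<partial>D) = (\<integral>y. y ^ 2 \<partial>G)"
  shows "\<bar>(\<integral>x. smooth_step ((x - a) / \<delta>) \<partial>(D \<star> \<rho>)) - (\<integral>x. smooth_step ((x - a) / \<delta>) \<partial>(G \<star> \<rho>))\<bar>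
    \<le> 4 / 3 / \<delta> ^ 3 * (((\<integral>y. \<bar>y\<bar> ^ 3 \<partial>D) + (\<integral>y. \<bar>y\<bar> ^ 3 \<partial>G)) * measure (D \<star> \<rho>) {a - 2 * \<delta>..}
        + (\<integral>y. \<bar>y\<bar> ^ 3 * indicator {y. \<delta> < \<bar>y\<bar>} y \<partial>G))"
proof -
  interpret D: real_distribution D by fact
  interpret G: real_distribution G by fact
  interpret R: real_distribution \<rho> by fact
  interpret DR: real_distribution "D \<star> \<rho>" by (rule real_distribution_convolution) fact+
  let ?f = "\<lambda>x. smooth_step ((x - a) / \<delta>)"
  define \<gamma> where "\<gamma> = (\<integral>y. \<bar>y\<bar> ^ 3 \<partial>D) + (\<integral>y. \<bar>y\<bar> ^ 3 \<partial>G)"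
  define \<tau> where "\<tau> = (\<integral>y. \<bar>y\<bar> ^ 3 * indicator {y. \<delta> < \<bar>y\<bar>} y \<partial>G)"
  have iD: "integrable D (\<lambda>y. \<bar>y\<bar> ^ 3)"
    using bd by (intro D.integrable_const_bound[of _ "\<delta> ^ 3"]) (auto elim!: eventually_mono intro: power_mono)
  have "(\<integral>y. \<bar>y\<bar> ^ 3 * indicator {y. \<delta> < \<bar>y\<bar>} y \<partial>D) = (\<integral>y. 0 \<partial>D)"
    using bd by (intro integral_cong_AE) (auto elim!: eventually_mono split: split_indicator)
  then have \<tau>D: "(\<integral>y. \<bar>y\<bar> ^ 3 * indicator {y. \<delta> < \<bar>y\<bar>} y \<partial>D) = 0" by simp
  have pw: "\<bar>(\<integral>y. ?f (s + y) \<partial>D) - (\<integral>y. ?f (s + y) \<partial>G)\<bar> \<le> 4 / 3 / \<delta> ^ 3 * (\<gamma> * indicator {a - \<delta>..} s + \<tau>)" for s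
  proof -
    obtain c where c: "\<forall>\<mu>. real_distribution \<mu> \<longrightarrow> integrable \<mu> (\<lambda>y. \<bar>y\<bar> ^ 3) \<longrightarrow> (\<integral>y. y \<partial>\<mu>) = 0 \<longrightarrow>
     \<bar>(\<integral>y. smooth_step ((s + y - a) / \<delta>) \<partial>\<mu>) - smooth_step ((s - a) / \<delta>) - c * (\<integral>y. y ^ 2 \<partial>\<mu>)\<bar>
     \<le> 4 / 3 / \<delta> ^ 3 *
        ((\<integral>y. \<bar>y\<bar> ^ 3 \<partial>\<mu>) * indicator {a - \<delta>..} s + (\<integral>y. \<bar>y\<bar> ^ 3 * indicator {y. \<delta> < \<bar>y\<bar>} y \<partial>\<mu>))"
      using smooth_step_expectation_taylor[OF \<delta>, of s a] by (elim exE) (rule that)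
    show ?thesis
      using c[rule_format, OF D iD mean(1)] c[rule_format, OF G iG mean(2)] unfolding var \<tau>D \<tau>_def[symmetric]
      by (simp add: \<gamma>_def algebra_simps)
  qed
  have [measurable]: "(\<lambda>s. \<integral>y. ?f (s + y) \<partial>D) \<in> borel_measurable borel"
    "(\<lambda>s. \<integral>y. ?f (s + y) \<partial>G) \<in> borel_measurable borel"
    by measurable
  have le1: "\<bar>\<integral>y. ?f (s + y) \<partial>\<mu>\<bar> \<le> 1" if "real_distribution \<mu>" for s \<mu>
  proof -
    interpret real_distribution \<mu> by fact
    have "\<bar>\<integral>y. ?f (s + y) \<partial>\<mu>\<bar> \<le> (\<integral>y. \<bar>?f (s + y)\<bar> \<partial>\<mu>)" by (rule integral_abs_bound)
    also have "\<dots> \<le> 1"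
      by (intro integral_le_const AE_I2 integrable_const_bound[of _ 1]) (auto simp: smooth_step_range)
    finally show ?thesis .
  qed
  have iDG: "integrable \<rho> (\<lambda>s. \<integral>y. ?f (s + y) \<partial>D)" "integrable \<rho> (\<lambda>s. \<integral>y. ?f (s + y) \<partial>G)"
    by (auto intro!: R.integrable_const_bound[of _ 1] le1 D G)
  have "\<bar>(\<integral>x. ?f x \<partial>(D \<star> \<rho>)) - (\<integral>x. ?f x \<partial>(G \<star> \<rho>))\<bar> =
      \<bar>\<integral>s. (\<integral>y. ?f (s + y) \<partial>D) - (\<integral>y. ?f (s + y) \<partial>G) \<partial>\<rho>\<bar>"
    using iDG by (simp add: integral_convolution[where B=1] D G R smooth_step_range)
  also have "\<dots> \<le> (\<integral>s. 4 / 3 / \<delta> ^ 3 * (\<gamma> * indicator {a - \<delta>..} s + \<tau>) \<partial>\<rho>)"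
  proof (rule order_trans[OF integral_abs_bound integral_mono])
    show "integrable \<rho> (\<lambda>s. 4 / 3 / \<delta> ^ 3 * (\<gamma> * indicator {a - \<delta>..} s + \<tau>))"
      by (intro integrable_mult_right Bochner_Integration.integrable_add R.integrable_const
          R.integrable_const_bound[where B=1]) auto
  qed (use iDG pw in auto)
  also have "\<dots> = 4 / 3 / \<delta> ^ 3 * (\<gamma> * measure \<rho> {a - \<delta>..} + \<tau>)"
  proof -
    have "integrable \<rho> (\<lambda>s. \<gamma> * indicator {a - \<delta>..} s :: real)"
      by (intro integrable_mult_right R.integrable_const_bound[where B=1]) auto
    moreover have "measure \<rho> UNIV = 1" using R.prob_space by simp
    ultimately show ?thesis by (simp del: integrable_mult_right_iff)
  qed
  also have "\<dots> \<le> 4 / 3 / \<delta> ^ 3 * (\<gamma> * measure (D \<star> \<rho>) {a - 2 * \<delta>..} + \<tau>)"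
  \<comment> \<open>Adding a jump of size at most \<delta> cannot move a point of
    \<open>{a - \<delta>..}\<close> below \<open>a - 2 * \<delta>\<close>, so the tail of \<rho> is
    dominated by that of \<open>D \<star> \<rho>\<close>.\<close>
  proof (intro mult_left_mono add_right_mono)
    have "measure \<rho> {a - \<delta>..} = (\<integral>s. indicator {a - \<delta>..} s \<partial>\<rho>)" by simp
    also have "\<dots> \<le> (\<integral>s. (\<integral>y. indicator {a - 2 * \<delta>..} (s + y) \<partial>D) \<partial>\<rho>)"
    proof (rule integral_mono)
      show "integrable \<rho> (\<lambda>s. \<integral>y. indicator {a - 2 * \<delta>..} (s + y) \<partial>D :: real)"
      proof (rule R.integrable_const_bound[of _ 1])
        show "AE s in \<rho>. norm (\<integral>y. indicator {a - 2 * \<delta>..} (s + y) \<partial>D :: real) \<le> 1"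
          by (intro AE_I2 order_trans[OF integral_norm_bound] D.integral_le_const D.integrable_const_bound[of _ 1])
             (auto split: split_indicator)
      qed measurable
      fix s
      show "indicator {a - \<delta>..} s \<le> (\<integral>y. indicator {a - 2 * \<delta>..} (s + y) \<partial>D :: real)"
      proof (cases "a - \<delta> \<le> s")
        case True
        have "(1::real) = (\<integral>y. 1 \<partial>D)" using D.prob_space by simp
        also have "\<dots> = (\<integral>y. indicator {a - 2 * \<delta>..} (s + y) \<partial>D)"
          using bd True by (intro integral_cong_AE) (auto elim!: eventually_mono split: split_indicator)
        finally show ?thesis using True by simp
      qed simp
    qed (auto intro!: R.integrable_const_bound[where B=1])
    also have "\<dots> = (\<integral>x. indicator {a - 2 * \<delta>..} x \<partial>(D \<star> \<rho>))"
      by (rule integral_convolution[symmetric, where B=1]) (auto simp: D R split: split_indicator)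
    finally show "measure \<rho> {a - \<delta>..} \<le> measure (D \<star> \<rho>) {a - 2 * \<delta>..}" by simp
    show "0 \<le> \<gamma>" unfolding \<gamma>_def by (intro add_nonneg_nonneg integral_nonneg) auto
  qed (use \<delta> in auto)
  finally show ?thesis unfolding \<gamma>_def \<tau>_def .
qed

section \<open>Convolution powers and the recursion over hybrid sums\<close>

primrec convolution_power :: "real measure \<Rightarrow> nat \<Rightarrow> real measure" where
  "convolution_power D 0 = return borel 0"
| "convolution_power D (Suc n) = (D \<star> convolution_power D n)"

lemma real_distribution_return: "real_distribution (return borel (c :: real))"
  by (simp add: real_distribution_def real_distribution_axioms_def prob_space_return)

lemma real_distribution_convolution_power:
  "real_distribution D \<Longrightarrow> real_distribution (convolution_power D n)"
  by (induction n) (auto intro: real_distribution_return real_distribution_convolution)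

lemma convolution_return_0:
  assumes "real_distribution D"
  shows "(D \<star> return borel 0) = D"
proof -
  interpret D: real_distribution D by fact
  interpret R: real_distribution "return borel (0::real)" by (rule real_distribution_return)
  show ?thesis
  proof (rule measure_eqI)
    fix A assume "A \<in> sets (D \<star> return borel 0)"
    then have A: "A \<in> sets borel" by simp
    have "emeasure (D \<star> return borel 0) A = (\<integral>\<^sup>+x. \<integral>\<^sup>+y. indicator A (x + y) \<partial>return borel 0 \<partial>D)"
      by (rule convolution_emeasure') (use A in \<open>auto simp: D.finite_measure_axioms R.finite_measure_axioms\<close>)
    also have "\<dots> = (\<integral>\<^sup>+x. indicator A x \<partial>D)"
      using A by (intro nn_integral_cong) (subst nn_integral_return, auto)
    finally show "emeasure (D \<star> return borel 0) A = emeasure D A" using A by simp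
  qed simp
qed

lemma smooth_step_integral_bounds:
  assumes "real_distribution \<mu>" "0 < \<delta>"
  shows "measure \<mu> {a + 3 * \<delta>..} \<le> (\<integral>x. smooth_step ((x - a) / \<delta>) \<partial>\<mu>)"
    and "(\<integral>x. smooth_step ((x - a) / \<delta>) \<partial>\<mu>) \<le> measure \<mu> {a..}"
proof -
  interpret real_distribution \<mu> by fact
  have i: "integrable \<mu> (\<lambda>x. smooth_step ((x - a) / \<delta>))"
    by (rule integrable_const_bound[of _ 1]) (auto simp: smooth_step_range)
  have j: "integrable \<mu> (indicator {c..} :: real \<Rightarrow> real)" for c
    by (rule integrable_const_bound[of _ 1]) (auto split: split_indicator)
  have "(\<integral>x. indicator {a + 3 * \<delta>..} x \<partial>\<mu>) \<le> (\<integral>x. smooth_step ((x - a) / \<delta>) \<partial>\<mu>)"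
  proof (rule integral_mono[OF j i])
    fix x
    show "indicator {a + 3 * \<delta>..} x \<le> smooth_step ((x - a) / \<delta>)"
      using assms(2) by (auto simp: smooth_step_range smooth_step_eq_1 field_simps split: split_indicator)
  qed
  then show "measure \<mu> {a + 3 * \<delta>..} \<le> (\<integral>x. smooth_step ((x - a) / \<delta>) \<partial>\<mu>)" by simp
  have "(\<integral>x. smooth_step ((x - a) / \<delta>) \<partial>\<mu>) \<le> (\<integral>x. indicator {a..} x \<partial>\<mu>)"
  proof (rule integral_mono[OF i j])
    fix x
    show "smooth_step ((x - a) / \<delta>) \<le> indicator {a..} x"
      using assms(2) by (auto simp: smooth_step_range smooth_step_eq_0 field_simps split: split_indicator)
  qed
  then show "(\<integral>x. smooth_step ((x - a) / \<delta>) \<partial>\<mu>) \<le> measure \<mu> {a..}" by simp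
qed

text \<open>The shift by \<open>5 * \<delta>\<close> in each round combines the width \<open>3 * \<delta>\<close> of the smoothed indicator with
  the loss of \<open>2 * \<delta>\<close> incurred when a tail of a hybrid bounds the third order error.\<close>
lemma tail_bound_iteration:
  fixes H :: "nat \<Rightarrow> real \<Rightarrow> real"
  assumes step: "\<And>b x. (\<And>j. j \<le> n \<Longrightarrow> H j (x - 5 * \<delta>) \<le> b) \<Longrightarrow>
      \<forall>j\<le>n. H j x \<le> N (x - 3 * \<delta>) + \<epsilon> * b + \<tau>"
    and le1: "\<And>j x. H j x \<le> 1"
    and N: "antimono N" "\<And>x. 0 \<le> N x"
    and \<epsilon>: "0 \<le> \<epsilon>" "2 * \<epsilon> \<le> 1" and \<tau>: "0 \<le> \<tau>" and \<delta>: "0 < \<delta>"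
  shows "j \<le> n \<Longrightarrow> H j x \<le> 2 * N (x - 5 * real r * \<delta>) + 2 * \<tau> + \<epsilon> ^ r"
proof (induction r arbitrary: j x)
  case 0
  \<comment> \<open>The recursion starts from the trivial bound 1, which is
    \<open>\<epsilon> ^ 0\<close>.\<close>
  then show ?case using le1[of j x] N(2)[of x] \<tau> by simp
next
  case (Suc r)
  define B where "B = N (x - 5 * real (Suc r) * \<delta>)"
  have "H j (x - 5 * \<delta>) \<le> 2 * B + 2 * \<tau> + \<epsilon> ^ r" if "j \<le> n" for j
    using Suc.IH[OF that, of "x - 5 * \<delta>"] by (simp add: B_def algebra_simps)
  then have "H j x \<le> N (x - 3 * \<delta>) + \<epsilon> * (2 * B + 2 * \<tau> + \<epsilon> ^ r) + \<tau>"
    using step Suc.prems by blast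
  moreover have "N (x - 3 * \<delta>) \<le> B"
    unfolding B_def using \<delta> by (intro antimonoD[OF N(1)]) (auto simp: algebra_simps)
  \<comment> \<open>Since \<open>2 * \<epsilon> \<le> 1\<close>, the factors 2 in front of
    \<open>N\<close> and \<tau> reproduce themselves and do not grow with the number of
    rounds.\<close>
  moreover have "2 * \<epsilon> * B \<le> B" "2 * \<epsilon> * \<tau> \<le> \<tau>"
    using \<epsilon> N(2) \<tau> by (auto simp: B_def intro!: mult_left_le_one_le)
  ultimately show ?case by (simp add: algebra_simps B_def)
qed

text \<open>The parameter \<delta> has two roles: it is the smoothing scale of the test function and
  an almost sure bound for one summand.\<close>

locale lindeberg_replacement =
  fixes D G :: "real measure" and n :: nat and \<delta> :: real
  assumes D: "real_distribution D" and G: "real_distribution G"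
    and \<delta>: "0 < \<delta>" and bd: "AE y in D. \<bar>y\<bar> \<le> \<delta>"
    and iG: "integrable G (\<lambda>y. \<bar>y\<bar> ^ 3)"
    and mean: "(\<integral>y. y \<partial>D) = 0" "(\<integral>y. y \<partial>G) = 0"
    and var: "(\<integral>y. y ^ 2 \<partial>D) = (\<integral>y. y ^ 2 \<partial>G)"
begin

definition hybrid :: "nat \<Rightarrow> real measure" where
  "hybrid j = (convolution_power D j \<star> convolution_power G (n - j))"

lemma real_distribution_hybrid: "real_distribution (hybrid j)"
  unfolding hybrid_def
  by (intro real_distribution_convolution real_distribution_convolution_power D G)

lemma hybrid_0: "hybrid 0 = convolution_power G n"
  and hybrid_n: "hybrid n = convolution_power D n"
proof -
  have fm: "finite_measure (convolution_power G m)" "sets (convolution_power G m) = sets borel" for m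
    using real_distribution_convolution_power[OF G, of m]
    by (auto simp: real_distribution_def prob_space_def real_distribution_axioms_def)
  have fr: "finite_measure (return borel (0::real))"
    using real_distribution_return[of 0] by (auto simp: real_distribution_def prob_space_def)
  show "hybrid 0 = convolution_power G n"
    unfolding hybrid_def using convolution_return_0[OF real_distribution_convolution_power[OF G, of n]]
    by (simp add: convolution_commutative[OF fr fm(1)] fm)
  show "hybrid n = convolution_power D n"
    unfolding hybrid_def by (simp add: convolution_return_0 real_distribution_convolution_power D)
qed

text \<open>Here \<rho> is the law of the sum without the summand being exchanged. Commutativity
  brings that summand to the front in both neighbouring hybrids.\<close>

lemma hybrid_step:
  assumes "j < n"
  obtains \<rho> where "real_distribution \<rho>" "hybrid (Suc j) = (D \<star> \<rho>)" "hybrid j = (G \<star> \<rho>)"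
proof
  let ?P = "convolution_power D j" and ?Q = "convolution_power G (n - Suc j)"
  have rd: "real_distribution ?P" "real_distribution ?Q"
    by (intro real_distribution_convolution_power D G)+
  have fin: "finite_measure M" "sets M = sets borel" if "real_distribution M" for M
    using that by (auto simp: real_distribution_def prob_space_def real_distribution_axioms_def)
  note f = fin[OF rd(1)] fin[OF rd(2)] fin[OF D] fin[OF G]
  show "real_distribution (?P \<star> ?Q)" by (intro real_distribution_convolution rd)
  show "hybrid (Suc j) = (D \<star> (?P \<star> ?Q))"
    unfolding hybrid_def by (simp add: convolution_associative f)
  have "hybrid j = (?P \<star> (G \<star> ?Q))"
    using assms unfolding hybrid_def by (simp add: Suc_diff_Suc[symmetric])
  also have "\<dots> = ((G \<star> ?P) \<star> ?Q)"
    by (simp add: convolution_associative f convolution_commutative[of ?P G])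
  also have "\<dots> = (G \<star> (?P \<star> ?Q))"
    by (simp add: convolution_associative f)
  finally show "hybrid j = (G \<star> (?P \<star> ?Q))" .
qed

text \<open>The costs of \<open>n\<close> single replacements are collected by kind: \<epsilon> will
  multiply tails of hybrids, while \<tau> is an absolute error caused by Gaussian jumps longer than
  \<delta>.\<close>

definition \<gamma> where "\<gamma> = (\<integral>y. \<bar>y\<bar> ^ 3 \<partial>D) + (\<integral>y. \<bar>y\<bar> ^ 3 \<partial>G)"
definition \<epsilon> where "\<epsilon> = real n * (4 / 3 / \<delta> ^ 3 * \<gamma>)"
definition \<tau> where
  "\<tau> = real n * (4 / 3 / \<delta> ^ 3 * (\<integral>y. \<bar>y\<bar> ^ 3 * indicator {y. \<delta> < \<bar>y\<bar>} y \<partial>G))"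

lemma \<gamma>_nonneg: "0 \<le> \<gamma>" unfolding \<gamma>_def by (intro add_nonneg_nonneg Bochner_Integration.integral_nonneg) auto

lemma \<epsilon>_nonneg: "0 \<le> \<epsilon>"
  using \<delta> \<gamma>_nonneg unfolding \<epsilon>_def by simp

lemma \<tau>_nonneg: "0 \<le> \<tau>"
proof -
  have "0 \<le> (\<integral>y. \<bar>y\<bar> ^ 3 * indicator {y. \<delta> < \<bar>y\<bar>} y \<partial>G)"
    by (intro Bochner_Integration.integral_nonneg) auto
  then show ?thesis using \<delta> unfolding \<tau>_def by simp
qed

text \<open>Telescoping from the all-Gaussian hybrid passes through every intermediate one, which is
  why the tails of all hybrids must be bounded at once.\<close>

lemma hybrid_smooth_step:
  assumes "j \<le> n" and b: "\<And>j. j \<le> n \<Longrightarrow> measure (hybrid j) {a - 2 * \<delta>..} \<le> b"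
  shows "\<bar>(\<integral>x. smooth_step ((x - a) / \<delta>) \<partial>(hybrid j)) - (\<integral>x. smooth_step ((x - a) / \<delta>) \<partial>(hybrid 0))\<bar>
    \<le> \<epsilon> * b + \<tau>"
proof -
  let ?I = "\<lambda>j. \<integral>x. smooth_step ((x - a) / \<delta>) \<partial>(hybrid j)"
  define t where "t = (\<integral>y. \<bar>y\<bar> ^ 3 * indicator {y. \<delta> < \<bar>y\<bar>} y \<partial>G)"
  define e where "e = 4 / 3 / \<delta> ^ 3 * (\<gamma> * b + t)"
  have t: "0 \<le> t" unfolding t_def by (intro Bochner_Integration.integral_nonneg) auto
  have b0: "0 \<le> b" using b[of 0] measure_nonneg order_trans by blast
  have "\<bar>?I (Suc i) - ?I i\<bar> \<le> e" if "i < n" for i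
  proof -
    obtain \<rho> where \<rho>: "real_distribution \<rho>" "hybrid (Suc i) = (D \<star> \<rho>)" "hybrid i = (G \<star> \<rho>)"
      using hybrid_step[OF \<open>i < n\<close>] .
    have "\<bar>?I (Suc i) - ?I i\<bar> \<le> 4 / 3 / \<delta> ^ 3 * (\<gamma> * measure (hybrid (Suc i)) {a - 2 * \<delta>..} + t)"
      using lindeberg_step[OF D G \<rho>(1) \<delta> bd iG mean var, of a] unfolding \<rho> t_def \<gamma>_def .
    also have "\<dots> \<le> e"
      unfolding e_def using b[of "Suc i"] that \<delta> \<gamma>_nonneg by (intro mult_left_mono add_right_mono) auto
    finally show ?thesis .
  qed
  then have "\<bar>?I j - ?I 0\<bar> \<le> real j * e" using \<open>j \<le> n\<close>
  proof (induction j)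
    case (Suc j)
    then have "\<bar>?I j - ?I 0\<bar> \<le> real j * e" "\<bar>?I (Suc j) - ?I j\<bar> \<le> e" by auto
    then show ?case by (simp add: algebra_simps abs_if split: if_splits)
  qed simp
  also have "\<dots> \<le> real n * e"
    using \<open>j \<le> n\<close> b0 t \<delta> \<gamma>_nonneg by (intro mult_right_mono) (auto simp: e_def)
  also have "\<dots> = \<epsilon> * b + \<tau>"
    by (simp add: e_def \<epsilon>_def \<tau>_def t_def algebra_simps add_divide_distrib)
  finally show ?thesis .
qed

text \<open>After \<open>r\<close> rounds the crude bound still has the factor 2 in front of the
  Gaussian tail. Feeding it into one last comparison multiplies it by \<epsilon>, so the main term
  has factor 1 and the absolute error becomes \<open>\<epsilon> ^ Suc r\<close>.\<close>

theorem replacement_sandwich: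
  assumes \<epsilon>: "2 * \<epsilon> \<le> 1" and N: "\<And>x. N x = measure (convolution_power G n) {x..}"
    and \<eta>: "\<eta> = 5 * real (Suc r) * \<delta>"
  shows "measure (convolution_power D n) {x..} \<le> (1 + 2 * \<epsilon>) * N (x - \<eta>) + 2 * \<tau> + \<epsilon> ^ Suc r"
    and "N (x + \<eta>) - 2 * \<epsilon> * N (x - \<eta>) - 2 * \<tau> - \<epsilon> ^ Suc r \<le> measure (convolution_power D n) {x..}"
proof -
  interpret H: real_distribution "hybrid j" for j by (rule real_distribution_hybrid)
  let ?H = "\<lambda>j x. measure (hybrid j) {x..}"
  have mono: "?H j x \<le> ?H j y" if "y \<le> x" for j x y
    using that by (intro H.finite_measure_mono) auto
  have N': "N x = ?H 0 x" for x by (simp add: N hybrid_0)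
  have anti: "antimono N" by (auto intro!: antimonoI mono simp: N')
  have "\<forall>j\<le>n. ?H j x \<le> N (x - 3 * \<delta>) + \<epsilon> * b + \<tau>" if b: "\<And>j. j \<le> n \<Longrightarrow> ?H j (x - 5 * \<delta>) \<le> b" for b x
  proof (intro allI impI)
    fix j assume "j \<le> n"
    \<comment> \<open>For the upper bound the ramp starts at \<open>x - 3 * \<delta>\<close>, so
      that the test function is already 1 at \<open>x\<close>.\<close>
    have "?H j x \<le> (\<integral>y. smooth_step ((y - (x - 3 * \<delta>)) / \<delta>) \<partial>(hybrid j))"
      using smooth_step_integral_bounds(1)[OF real_distribution_hybrid \<delta>, of j "x - 3 * \<delta>"] by simp
    also have "\<dots> \<le> (\<integral>y. smooth_step ((y - (x - 3 * \<delta>)) / \<delta>) \<partial>(hybrid 0)) + (\<epsilon> * b + \<tau>)"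
      using hybrid_smooth_step[OF \<open>j \<le> n\<close>, of "x - 3 * \<delta>" b] b by auto
    also have "\<dots> \<le> N (x - 3 * \<delta>) + (\<epsilon> * b + \<tau>)"
      unfolding N' by (intro add_right_mono smooth_step_integral_bounds(2) real_distribution_hybrid \<delta>)
    finally show "?H j x \<le> N (x - 3 * \<delta>) + \<epsilon> * b + \<tau>" by simp
  qed
  note step = this
  have bound: "?H j y \<le> 2 * N (y - 5 * real r * \<delta>) + 2 * \<tau> + \<epsilon> ^ r" if "j \<le> n" for j y
    by (rule tail_bound_iteration[where H = ?H and n = n, OF step _ anti _ \<epsilon>_nonneg \<epsilon> \<tau>_nonneg \<delta> that])
       (auto simp: N')
  \<comment> \<open>Bounds every hybrid tail at \<open>x - 5 * \<delta>\<close>: 3 from the ramp and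
    2 from the jump. The lower bound only needs \<open>x - 2 * \<delta>\<close>, where tails are
    smaller.\<close>
  define b where "b = 2 * N (x - \<eta>) + 2 * \<tau> + \<epsilon> ^ r"
  have b: "?H j (x - 5 * \<delta>) \<le> b" if "j \<le> n" for j
    using bound[OF that, of "x - 5 * \<delta>"] by (simp add: b_def \<eta> algebra_simps)
  have \<tau>': "2 * \<epsilon> * \<tau> \<le> \<tau>" using \<epsilon> \<epsilon>_nonneg \<tau>_nonneg by (auto intro!: mult_left_le_one_le)
  have "?H n x \<le> N (x - 3 * \<delta>) + \<epsilon> * b + \<tau>" using step[of x b] b by auto
  moreover have "N (x - 3 * \<delta>) \<le> N (x - \<eta>)" "N (x + \<eta>) \<le> N (x + 3 * \<delta>)"
    using \<delta> by (auto intro!: antimonoD[OF anti] simp: \<eta> algebra_simps)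
  moreover have "N (x + 3 * \<delta>) - (\<epsilon> * b + \<tau>) \<le> ?H n x"
  proof -
    have b': "?H j (x - 2 * \<delta>) \<le> b" if "j \<le> n" for j
      using b[OF that] mono[of "x - 5 * \<delta>" "x - 2 * \<delta>" j] \<delta> by simp
    \<comment> \<open>For the lower bound the ramp starts at \<open>x\<close>, so the test function
      stays below the indicator of \<open>{x..}\<close> and reaches 1 at
      \<open>x + 3 * \<delta>\<close>.\<close>
    have "N (x + 3 * \<delta>) \<le> (\<integral>y. smooth_step ((y - x) / \<delta>) \<partial>(hybrid 0))"
      unfolding N' by (rule smooth_step_integral_bounds(1)[OF real_distribution_hybrid \<delta>])
    also have "\<dots> \<le> (\<integral>y. smooth_step ((y - x) / \<delta>) \<partial>(hybrid n)) + (\<epsilon> * b + \<tau>)"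
      using hybrid_smooth_step[of n x b] b' by auto
    also have "\<dots> \<le> ?H n x + (\<epsilon> * b + \<tau>)"
      by (intro add_right_mono smooth_step_integral_bounds(2) real_distribution_hybrid \<delta>)
    finally show ?thesis by simp
  qed
  ultimately show "measure (convolution_power D n) {x..} \<le> (1 + 2 * \<epsilon>) * N (x - \<eta>) + 2 * \<tau> + \<epsilon> ^ Suc r"
    and "N (x + \<eta>) - 2 * \<epsilon> * N (x - \<eta>) - 2 * \<tau> - \<epsilon> ^ Suc r \<le> measure (convolution_power D n) {x..}"
    using \<tau>' unfolding b_def hybrid_n[symmetric] by (simp_all add: algebra_simps)
qed

end

section \<open>From sums of independent variables to convolution powers\<close>

lemma (in prob_space) distr_sum_convolution_power:
  fixes Z :: "nat \<Rightarrow> 'a \<Rightarrow> real"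
  assumes indep: "indep_vars (\<lambda>_. borel) Z {1..n}"
    and distr: "\<And>i. i \<in> {1..n} \<Longrightarrow> distr M borel (Z i) = D"
  shows "distr M borel (\<lambda>\<omega>. \<Sum>i=1..n. Z i \<omega>) = convolution_power D n"
  using assms
proof (induction n)
  case 0
  have "distr M borel (\<lambda>\<omega>. 0::real) = return borel 0"
    by (rule distr_const) simp
  then show ?case by simp
next
  case (Suc n)
  have ins: "{1..Suc n} = insert (Suc n) {1..n}" by auto
  have rv: "random_variable borel (Z i)" if "i \<in> {1..Suc n}" for i
    using Suc.prems(1) that unfolding indep_vars_def by blast
  have "indep_var borel (Z (Suc n)) borel (\<lambda>\<omega>. \<Sum>i\<in>{1..n}. Z i \<omega>)"
    using Suc.prems(1) unfolding ins by (intro indep_vars_sum) auto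
  then have "distr M borel (\<lambda>\<omega>. Z (Suc n) \<omega> + (\<Sum>i=1..n. Z i \<omega>)) =
      (distr M borel (Z (Suc n)) \<star> distr M borel (\<lambda>\<omega>. \<Sum>i=1..n. Z i \<omega>))"
    by (rule sum_indep_random_variable) (auto intro!: borel_measurable_sum rv)
  also have "\<dots> = convolution_power D (Suc n)"
    using Suc.prems(2)[of "Suc n"] Suc.IH[OF indep_vars_subset[OF Suc.prems(1)]] Suc.prems(2) by simp
  finally show ?case by (simp add: add.commute)
qed

lemma convolution_power_normal:
  assumes [arith]: "0 < \<sigma>"
  shows "convolution_power (density lborel (normal_density 0 \<sigma>)) (Suc n) =
    density lborel (normal_density 0 (\<sigma> * sqrt (real (Suc n))))"
proof (induction n)
  case 0
  have "real_distribution (density lborel (normal_density 0 \<sigma>))"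
    by (simp add: real_distribution_def real_distribution_axioms_def prob_space_normal_density)
  then show ?case by (simp add: convolution_return_0)
next
  case (Suc n)
  define \<sigma>' where "\<sigma>' = \<sigma> * sqrt (real (Suc n))"
  have [arith]: "0 < \<sigma>'" by (simp add: \<sigma>'_def)
  have fin: "finite_measure (density lborel (normal_density 0 s))" if "0 < s" for s
    using prob_space_normal_density[OF that] by (simp add: prob_space_def)
  have "(density lborel (normal_density 0 \<sigma>) \<star> density lborel (normal_density 0 \<sigma>')) =
      density lborel (\<lambda>x. \<integral>\<^sup>+y. ennreal (normal_density 0 \<sigma> (x - y)) * ennreal (normal_density 0 \<sigma>' y) \<partial>lborel)"
    by (rule convolution_density) (auto intro!: fin)
  also have "\<dots> = density lborel (normal_density 0 (sqrt (\<sigma>\<^sup>2 + \<sigma>'\<^sup>2)))"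
    by (simp add: ennreal_mult'[symmetric] conv_normal_density_zero_mean)
  also have "\<sigma>\<^sup>2 + \<sigma>'\<^sup>2 = \<sigma>\<^sup>2 * real (Suc (Suc n))"
    by (simp add: \<sigma>'_def power_mult_distrib algebra_simps)
  finally show ?case
    using Suc.IH by (simp add: \<sigma>'_def real_sqrt_mult del: of_nat_Suc)
qed

text \<open>The case \<open>k = 1\<close> supplies the third moment of the Gaussian summand. Large
  \<open>k\<close> supplies the Markov bound for its jumps beyond \<delta>, of any polynomial
  order.\<close>

lemma normal_abs_moment_odd:
  assumes \<sigma>: "0 < \<sigma>"
  shows "integrable (density lborel (normal_density 0 \<sigma>)) (\<lambda>y. \<bar>y\<bar> ^ (2 * k + 1))"
    and "(\<integral>y. \<bar>y\<bar> ^ (2 * k + 1) \<partial>density lborel (normal_density 0 \<sigma>)) \<le> 2 ^ k * fact k * \<sigma> ^ (2 * k + 1)"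
proof -
  have hb: "has_bochner_integral lborel (\<lambda>x. normal_density 0 \<sigma> x * \<bar>x\<bar> ^ (2 * k + 1))
      (2 ^ k * \<sigma> ^ (2 * k + 1) * fact k * sqrt (2 / pi))"
    using normal_moment_abs_odd[OF \<sigma>, of 0 k] by simp
  show "integrable (density lborel (normal_density 0 \<sigma>)) (\<lambda>y. \<bar>y\<bar> ^ (2 * k + 1))"
    using integrable.intros[OF hb] by (subst integrable_density) auto
  have "(\<integral>y. \<bar>y\<bar> ^ (2 * k + 1) \<partial>density lborel (normal_density 0 \<sigma>)) =
      2 ^ k * \<sigma> ^ (2 * k + 1) * fact k * sqrt (2 / pi)"
    using has_bochner_integral_integral_eq[OF hb] by (subst integral_density) auto
  also have "\<dots> \<le> 2 ^ k * \<sigma> ^ (2 * k + 1) * fact k * 1"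
    using \<sigma> pi_gt3 by (intro mult_left_mono) auto
  finally show "(\<integral>y. \<bar>y\<bar> ^ (2 * k + 1) \<partial>density lborel (normal_density 0 \<sigma>)) \<le> 2 ^ k * fact k * \<sigma> ^ (2 * k + 1)"
    by (simp add: mult_ac)
qed

text \<open>Each summand is scaled by 1 / sqrt n. In \<open>e\<close>, the term \<open>K ^ 3\<close>
  bounds the third absolute moment of \<open>Y 1\<close> and 2 that of a standard Gaussian; in
  \<open>t\<close>, the free parameter \<open>q\<close> is the order of the Gaussian moment used
  beyond \<delta>.\<close>

lemma (in prob_space) iid_sum_tail_sandwich:
  fixes Y :: "nat \<Rightarrow> 'a \<Rightarrow> real"
  assumes n: "1 \<le> n" and indep: "indep_vars (\<lambda>_. borel) Y {1..n}"
    and ident: "\<And>i. i \<in> {1..n} \<Longrightarrow> distr M borel (Y i) = distr M borel (Y 1)"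
    and bound: "AE \<omega> in M. \<bar>Y 1 \<omega>\<bar> \<le> K" and K: "0 \<le> K"
    and mean: "expectation (Y 1) = 0" and var: "expectation (\<lambda>\<omega>. Y 1 \<omega> ^ 2) = 1"
    and \<delta>: "0 < \<delta>" "K \<le> sqrt (real n) * \<delta>"
    and e: "e = 4 / 3 * (K ^ 3 + 2) / (sqrt (real n) * \<delta> ^ 3)" "2 * e \<le> 1"
    and t: "t = 4 / 3 * 2 ^ Suc q * fact (Suc q) * real n / (sqrt (real n) * \<delta>) ^ (2 * q + 3)"
    and \<eta>: "\<eta> = 5 * real (Suc r) * \<delta>"
    and N: "\<And>x. N x = measure std_normal_distribution {x..}"
    and P: "\<And>x. P x = prob {\<omega>\<in>space M. x \<le> (\<Sum>i=1..n. Y i \<omega>) / sqrt (real n)}"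
  shows "P x \<le> (1 + 2 * e) * N (x - \<eta>) + 2 * t + e ^ Suc r"
    and "N (x + \<eta>) - 2 * e * N (x - \<eta>) - 2 * t - e ^ Suc r \<le> P x"
proof -
  note One_nat_def [simp del]
  define s where "s = 1 / sqrt (real n)"
  have s: "0 < s" "s ^ 2 = 1 / real n" using n by (auto simp: s_def power_divide)
  have ns: "real n = 1 / s ^ 2" "sqrt (real n) = 1 / s" using n by (auto simp: s_def power_divide)
  have rv [measurable]: "random_variable borel (Y i)" if "i \<in> {1..n}" for i
    using indep that unfolding indep_vars_def by blast
  have rv1 [measurable]: "random_variable borel (Y 1)" using n by (intro rv) auto
  define D where "D = distr M borel (\<lambda>\<omega>. s * Y 1 \<omega>)"
  define G where "G = density lborel (normal_density 0 s)"
  have D: "real_distribution D"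
    unfolding D_def real_distribution_def real_distribution_axioms_def
    by (auto simp del: One_nat_def intro!: prob_space_distr)
  have G: "real_distribution G"
    unfolding G_def by (simp add: real_distribution_def real_distribution_axioms_def prob_space_normal_density s)
  have dist: "distr M borel (\<lambda>\<omega>. s * Y i \<omega>) = D" if "i \<in> {1..n}" for i
  proof -
    have "distr M borel (\<lambda>\<omega>. s * Y j \<omega>) = distr (distr M borel (Y j)) borel (\<lambda>x. s * x)" if "j \<in> {1..n}" for j
      using that by (subst distr_distr) (auto simp: comp_def)
    then show ?thesis using that ident[OF that] n unfolding D_def by simp
  qed
  have "distr M borel (\<lambda>\<omega>. \<Sum>i=1..n. s * Y i \<omega>) = convolution_power D n"
    by (rule distr_sum_convolution_power[OF indep_vars_compose2[OF indep] dist]) simp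
  then have P': "P x = measure (convolution_power D n) {x..}" for x
    unfolding P by (subst (asm) eq_commute)
      (auto simp: measure_distr sum_divide_distrib s_def vimage_def Int_def conj_commute intro!: arg_cong[where f=prob])
  obtain n' where n': "n = Suc n'" using n by (cases n) auto
  have "convolution_power G n = std_normal_distribution"
    unfolding n' G_def using s ns(2) by (subst convolution_power_normal) (simp_all flip: n')
  then have N': "N x = measure (convolution_power G n) {x..}" for x by (simp add: N)
  have bdD: "AE y in D. \<bar>y\<bar> \<le> s * K"
    unfolding D_def using bound s by (subst AE_distr_iff) (auto simp: abs_mult elim!: eventually_mono)
  have sK: "s * K \<le> \<delta>" using \<delta> s unfolding ns(2) by (simp add: field_simps)
  have G1: "(\<integral>y. y \<partial>G) = 0" and G2: "(\<integral>y. y ^ 2 \<partial>G) = s ^ 2"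
  proof -
    show "(\<integral>y. y \<partial>G) = 0"
      using integral_normal_moment_odd[OF s(1), of 0 0] unfolding G_def by (subst integral_density) auto
    show "(\<integral>y. y ^ 2 \<partial>G) = s ^ 2"
      using integral_normal_moment_even[OF s(1), of 0 1] unfolding G_def
      by (subst integral_density) (auto simp: fact_numeral)
  qed
  have G3: "integrable G (\<lambda>y. \<bar>y\<bar> ^ 3)" "(\<integral>y. \<bar>y\<bar> ^ 3 \<partial>G) \<le> 2 * s ^ 3"
    using normal_abs_moment_odd[OF s(1), of 1] unfolding G_def by simp_all
  have DG: "(\<integral>y. y \<partial>D) = 0" "(\<integral>y. y ^ 2 \<partial>D) = (\<integral>y. y ^ 2 \<partial>G)"
    unfolding D_def G2 using mean var by (simp_all add: integral_distr power_mult_distrib)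
  have "AE y in D. \<bar>y\<bar> \<le> \<delta>" using bdD by eventually_elim (use sK in auto)
  then interpret L: lindeberg_replacement D G n \<delta>
    by (intro lindeberg_replacement.intro D G \<delta> G1 G3 DG)
  interpret D: real_distribution D by fact
  interpret G: real_distribution G by fact
  have "(\<integral>y. \<bar>y\<bar> ^ 3 \<partial>D) \<le> (s * K) ^ 3"
    using bdD by (intro D.integral_le_const D.integrable_const_bound[of _ "(s * K) ^ 3"])
      (auto elim!: eventually_mono intro: power_mono)
  then have "L.\<gamma> \<le> s ^ 3 * (K ^ 3 + 2)"
    unfolding L.\<gamma>_def using G3 by (simp add: power_mult_distrib algebra_simps)
  then have "L.\<epsilon> \<le> real n * (4 / 3 / \<delta> ^ 3 * (s ^ 3 * (K ^ 3 + 2)))"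
    unfolding L.\<epsilon>_def using \<delta> by (intro mult_left_mono) auto
  also have "\<dots> = e"
  proof -
    have "1 / s ^ 2 * (4 / 3 / \<delta> ^ 3 * (s ^ 3 * C)) = 4 / 3 * C / (1 / s * \<delta> ^ 3)" for C
      using s(1) \<delta>(1) by (simp add: field_simps power2_eq_square power3_eq_cube)
    then show ?thesis unfolding e ns(2) unfolding ns(1) .
  qed
  finally have \<epsilon>: "L.\<epsilon> \<le> e" .
  have ex: "2 * Suc q + 1 = 3 + 2 * q" by simp
  \<comment> \<open>Markov: where \<open>\<bar>y\<bar>\<close> exceeds \<delta>, the factor
    \<open>(\<bar>y\<bar> / \<delta>) ^ (2 * q)\<close> is at least 1.\<close>
  have "(\<integral>y. \<bar>y\<bar> ^ 3 * indicator {y. \<delta> < \<bar>y\<bar>} y \<partial>G) \<le> (\<integral>y. \<bar>y\<bar> ^ (2 * Suc q + 1) / \<delta> ^ (2 * q) \<partial>G)"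
  proof (rule integral_mono)
    show "integrable G (\<lambda>y. \<bar>y\<bar> ^ 3 * indicator {y. \<delta> < \<bar>y\<bar>} y)"
      by (rule integrable_real_mult_indicator[OF _ G3(1)]) simp
    show "integrable G (\<lambda>y. \<bar>y\<bar> ^ (2 * Suc q + 1) / \<delta> ^ (2 * q))"
      using normal_abs_moment_odd(1)[OF s(1), of "Suc q"] unfolding G_def by simp
    fix y :: real
    show "\<bar>y\<bar> ^ 3 * indicator {y. \<delta> < \<bar>y\<bar>} y \<le> \<bar>y\<bar> ^ (2 * Suc q + 1) / \<delta> ^ (2 * q)"
    proof (cases "\<delta> < \<bar>y\<bar>")
      case True
      then have "\<bar>y\<bar> ^ 3 * \<delta> ^ (2 * q) \<le> \<bar>y\<bar> ^ 3 * \<bar>y\<bar> ^ (2 * q)"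
        using \<delta> by (intro mult_left_mono power_mono) auto
      also have "\<dots> = \<bar>y\<bar> ^ (2 * Suc q + 1)" unfolding ex by (simp only: power_add)
      finally show ?thesis using True \<delta> by (simp add: field_simps)
    qed (use \<delta> in auto)
  qed
  also have "\<dots> \<le> 2 ^ Suc q * fact (Suc q) * s ^ (2 * Suc q + 1) / \<delta> ^ (2 * q)"
    using normal_abs_moment_odd(2)[OF s(1), of "Suc q"] \<delta> unfolding G_def integral_divide_zero
    by (intro divide_right_mono) auto
  finally have "L.\<tau> \<le> real n * (4 / 3 / \<delta> ^ 3 * (2 ^ Suc q * fact (Suc q) * s ^ (2 * Suc q + 1) / \<delta> ^ (2 * q)))"
    unfolding L.\<tau>_def using \<delta> by (intro mult_left_mono) auto
  also have "\<dots> = t"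
  proof -
    have "(1 / s * \<delta>) ^ (2 * q + 3) = \<delta> ^ 3 * \<delta> ^ (2 * q) / s ^ (2 * Suc q + 1)"
      unfolding ex by (simp add: power_divide power_add mult.commute)
    then show ?thesis unfolding t ns(2) unfolding ns(1) by simp
  qed
  finally have \<tau>: "L.\<tau> \<le> t" .
  have N0: "0 \<le> N y" for y by (simp add: N)
  have pw: "L.\<epsilon> ^ Suc r \<le> e ^ Suc r" by (rule power_mono[OF \<epsilon> L.\<epsilon>_nonneg])
  have m: "2 * L.\<epsilon> * N (x - \<eta>) \<le> 2 * e * N (x - \<eta>)"
    using \<epsilon> N0 by (intro mult_right_mono) auto
  have "2 * L.\<epsilon> \<le> 1" using \<epsilon> e(2) by simp
  note sw = L.replacement_sandwich[OF this N' \<eta>, of x]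
  show "P x \<le> (1 + 2 * e) * N (x - \<eta>) + 2 * t + e ^ Suc r"
    using sw(1) m pw \<tau> unfolding P' by (simp add: algebra_simps)
  show "N (x + \<eta>) - 2 * e * N (x - \<eta>) - 2 * t - e ^ Suc r \<le> P x"
    using sw(2) m pw \<tau> unfolding P' by linarith
qed

section \<open>Tails of the standard normal distribution\<close>

text \<open>The half-line is closed to match the tails in the replacement argument; the Gaussian law
  has no atoms, so this is still 1 - \<Phi>.\<close>

definition normal_tail :: "real \<Rightarrow> real" where
  "normal_tail x = measure std_normal_distribution {x..}"

lemma measure_std_normal:
  assumes [measurable]: "A \<in> sets borel"
  shows "measure std_normal_distribution A = (\<integral>x. std_normal_density x * indicator A x \<partial>lborel)"
proof -
  have "measure std_normal_distribution A = (\<integral>x. indicator A x \<partial>std_normal_distribution)" by simp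
  also have "\<dots> = (\<integral>x. std_normal_density x * indicator A x \<partial>lborel)"
    by (subst integral_density) auto
  finally show ?thesis .
qed

lemma measure_std_normal_interval:
  assumes "a \<le> b"
  shows "(\<And>x. a \<le> x \<Longrightarrow> x < b \<Longrightarrow> std_normal_density x \<le> C) \<Longrightarrow>
      measure std_normal_distribution {a..<b} \<le> C * (b - a)"
    and "(\<And>x. a \<le> x \<Longrightarrow> x < b \<Longrightarrow> C \<le> std_normal_density x) \<Longrightarrow>
      C * (b - a) \<le> measure std_normal_distribution {a..<b}"
proof -
  have i: "integrable lborel (\<lambda>x. std_normal_density x * indicator {a..<b} x)"
    by (intro integrable_real_mult_indicator integrable_normal_density) auto
  have c: "has_bochner_integral lborel (\<lambda>x. C * indicator {a..<b} x) (C * (b - a))"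
    using assms by (intro has_bochner_integral_mult_right) (simp add: has_bochner_integral_iff)
  note c = integrable.intros[OF c] has_bochner_integral_integral_eq[OF c, symmetric]
  show "measure std_normal_distribution {a..<b} \<le> C * (b - a)"
    if "\<And>x. a \<le> x \<Longrightarrow> x < b \<Longrightarrow> std_normal_density x \<le> C"
    unfolding c(2) by (subst measure_std_normal, simp, rule integral_mono[OF i c(1)])
      (use that in \<open>auto split: split_indicator\<close>)
  show "C * (b - a) \<le> measure std_normal_distribution {a..<b}"
    if "\<And>x. a \<le> x \<Longrightarrow> x < b \<Longrightarrow> C \<le> std_normal_density x"
    unfolding c(2) by (subst measure_std_normal, simp, rule integral_mono[OF c(1) i])
      (use that in \<open>auto split: split_indicator\<close>)
qed

interpretation std_normal: real_distribution std_normal_distribution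
  by (rule real_dist_normal_dist)

lemma normal_tail_diff:
  assumes "x \<le> y"
  shows "normal_tail x - normal_tail y = measure std_normal_distribution {x..<y}"
proof -
  have "{x..} = {x..<y} \<union> {y..}" using assms by auto
  then have "normal_tail x = measure std_normal_distribution ({x..<y} \<union> {y..})"
    by (simp only: normal_tail_def)
  also have "\<dots> = measure std_normal_distribution {x..<y} + normal_tail y"
    unfolding normal_tail_def by (rule std_normal.finite_measure_Union) auto
  finally show ?thesis by simp
qed

lemma normal_tail_mono: "x \<le> y \<Longrightarrow> normal_tail y \<le> normal_tail x"
  using normal_tail_diff[of x y] measure_nonneg[of std_normal_distribution "{x..<y}"] by linarith

lemma normal_tail_nonneg: "0 \<le> normal_tail x"
  by (simp add: normal_tail_def)

lemma std_normal_singleton: "measure std_normal_distribution {x} = 0"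
proof -
  have "measure std_normal_distribution {x} = (\<integral>y. std_normal_density y * indicator {x} y \<partial>lborel)"
    by (rule measure_std_normal) simp
  also have "\<dots> = (\<integral>(y::real). 0 \<partial>lborel)"
  proof (rule integral_cong_AE)
    show "AE y in lborel. std_normal_density y * indicator {x} y = 0"
      using AE_lborel_singleton[of x] by eventually_elim simp
  qed simp_all
  finally show ?thesis by simp
qed

lemma normal_tail_eq: "normal_tail x = 1 - std_normal_cdf x"
proof -
  have "{x..} = {x} \<union> {x<..}" by auto
  then have "normal_tail x = measure std_normal_distribution ({x} \<union> {x<..})"
    by (simp only: normal_tail_def)
  also have "\<dots> = measure std_normal_distribution {x} + measure std_normal_distribution {x<..}"
    by (rule std_normal.finite_measure_Union) auto
  also have "\<dots> = measure std_normal_distribution {x<..}" by (simp add: std_normal_singleton)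
  also have "{x<..} = space std_normal_distribution - {..x}" by auto
  also have "measure std_normal_distribution \<dots> = 1 - std_normal_cdf x"
    by (subst std_normal.prob_compl) (auto simp: std_normal_cdf_def cdf_def)
  finally show ?thesis .
qed

lemma std_normal_cdf_minus: "std_normal_cdf (- x) = normal_tail x"
proof -
  have "std_normal_cdf (- x) = (\<integral>y. std_normal_density y * indicator {..- x} y \<partial>lborel)"
    unfolding std_normal_cdf_def cdf_def by (simp add: measure_std_normal)
  also have "\<dots> = (\<integral>y. std_normal_density (- y) * indicator {..- x} (- y) \<partial>lborel)"
    by (subst lborel_integral_real_affine[where c="-1" and t=0]) auto
  also have "\<dots> = (\<integral>y. std_normal_density y * indicator {x..} y \<partial>lborel)"
    by (intro Bochner_Integration.integral_cong) (auto simp: std_normal_density_def split: split_indicator)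
  finally show ?thesis unfolding normal_tail_def by (simp add: measure_std_normal)
qed

text \<open>The density drops by at most a constant factor on an interval of length \<open>1 / (1 + \<bar>x\<bar>)\<close>
  to the right of \<open>x\<close>.\<close>
lemma normal_tail_lower:
  "std_normal_density x * exp (- (3 / 2)) \<le> (1 + \<bar>x\<bar>) * normal_tail x"
proof -
  define h where "h = 1 / (1 + \<bar>x\<bar>)"
  have h: "0 < h" "h \<le> 1" "\<bar>x\<bar> * h \<le> 1" "(1 + \<bar>x\<bar>) * h = 1" by (auto simp: h_def field_simps)
  have "std_normal_density x * exp (- (3 / 2)) * (x + h - x) \<le> measure std_normal_distribution {x..<x + h}"
  proof (rule measure_std_normal_interval(2))
    fix y assume y: "x \<le> y" "y < x + h"
    have "\<bar>y\<bar> \<le> \<bar>x\<bar> + h" using y h by auto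
    then have "y ^ 2 \<le> (\<bar>x\<bar> + h) ^ 2" by (metis abs_ge_zero power2_abs power_mono)
    also have "\<dots> = x ^ 2 + 2 * (\<bar>x\<bar> * h) + h ^ 2" by (simp add: power2_sum)
    \<comment> \<open>The increment 2 |x| h + h^2 is at most 3; halved in the exponent, it gives the
      factor \<open>exp (- (3 / 2))\<close>.\<close>
    also have "\<dots> \<le> x ^ 2 + 3" using h power_le_one[of h 2] by auto
    finally have "- (x ^ 2) / 2 - 3 / 2 \<le> - (y ^ 2) / 2" by simp
    then have "exp (- (x ^ 2) / 2) * exp (- (3 / 2)) \<le> exp (- (y ^ 2) / 2)"
      by (simp add: exp_add[symmetric])
    then show "std_normal_density x * exp (- (3 / 2)) \<le> std_normal_density y"
      by (simp add: std_normal_density_def divide_right_mono)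
  qed (use h in auto)
  also have "\<dots> = normal_tail x - normal_tail (x + h)" using h by (simp add: normal_tail_diff)
  also have "\<dots> \<le> normal_tail x" using normal_tail_nonneg by simp
  finally have "std_normal_density x * exp (- (3 / 2)) * h \<le> normal_tail x" by simp
  then have "(1 + \<bar>x\<bar>) * (std_normal_density x * exp (- (3 / 2)) * h) \<le> (1 + \<bar>x\<bar>) * normal_tail x"
    by (intro mult_left_mono) auto
  moreover have "(1 + \<bar>x\<bar>) * (std_normal_density x * exp (- (3 / 2)) * h) = std_normal_density x * exp (- (3 / 2))"
    using h(4) by (metis mult.left_commute mult.right_neutral)
  ultimately show ?thesis by simp
qed

lemma normal_tail_pos: "0 < normal_tail x"
proof -
  have "0 < std_normal_density x * exp (- (3 / 2))" by (simp add: normal_density_pos)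
  also have "\<dots> \<le> (1 + \<bar>x\<bar>) * normal_tail x" by (rule normal_tail_lower)
  finally show ?thesis by (rule zero_less_mult_pos) simp
qed

text \<open>Within distance \<open>h\<close> of \<open>x\<close> the density exceeds its value at
  \<open>x\<close> by a factor of at most \<open>exp 1\<close>, because
  \<open>\<bar>x\<bar> * h \<le> 1\<close>. By \<open>normal_tail_lower\<close> that value is at
  most \<open>exp (3 / 2) * (1 + \<bar>x\<bar>)\<close> times the tail. The product
  \<open>exp (5 / 2)\<close> is rounded up to \<open>exp 3\<close>.\<close>

lemma normal_tail_shift:
  assumes h: "0 \<le> h" "\<bar>x\<bar> * h \<le> 1"
  shows "normal_tail (x - h) \<le> (1 + exp 3 * (h * (1 + \<bar>x\<bar>))) * normal_tail x"
    and "(1 - exp 3 * (h * (1 + \<bar>x\<bar>))) * normal_tail x \<le> normal_tail (x + h)"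
proof -
  let ?C = "std_normal_density x * exp 1"
  have dens: "std_normal_density y \<le> ?C" if "\<bar>y - x\<bar> \<le> h" for y
  proof -
    have "x * (x - y) \<le> \<bar>x\<bar> * \<bar>x - y\<bar>" by (metis abs_mult abs_ge_self)
    also have "\<dots> \<le> \<bar>x\<bar> * h" using that by (intro mult_left_mono) auto
    finally have "x * (x - y) \<le> \<bar>x\<bar> * h" .
    moreover have "0 \<le> (x - y) ^ 2" by simp
    ultimately have "x ^ 2 - 2 \<le> y ^ 2"
      using h by (simp add: power2_eq_square algebra_simps)
    then have "exp (- (y ^ 2) / 2) \<le> exp (- (x ^ 2) / 2) * exp 1" by (simp add: exp_add[symmetric])
    then show ?thesis by (simp add: std_normal_density_def divide_right_mono)
  qed
  have e1: "exp (- (3 / 2)) * exp (5 / 2) = exp (1::real)" by (simp add: exp_add[symmetric])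
  have "?C = std_normal_density x * exp (- (3 / 2)) * exp (5 / 2)" unfolding mult.assoc e1 ..
  also have "\<dots> \<le> (1 + \<bar>x\<bar>) * normal_tail x * exp (5 / 2)"
    by (intro mult_right_mono normal_tail_lower) simp
  also have "\<dots> \<le> (1 + \<bar>x\<bar>) * normal_tail x * exp 3"
    using normal_tail_nonneg[of x] by (intro mult_left_mono) auto
  finally have C: "?C \<le> exp 3 * (1 + \<bar>x\<bar>) * normal_tail x" by (simp add: mult_ac)
  then have hC: "?C * h \<le> exp 3 * (h * (1 + \<bar>x\<bar>)) * normal_tail x"
    using mult_right_mono[OF C h(1)] by (simp add: mult_ac)
  have "normal_tail (x - h) - normal_tail x \<le> ?C * (x - (x - h))"
    unfolding normal_tail_diff[of "x - h" x, simplified, OF h(1)]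
    by (rule measure_std_normal_interval(1)) (use h in \<open>auto intro: dens\<close>)
  then show "normal_tail (x - h) \<le> (1 + exp 3 * (h * (1 + \<bar>x\<bar>))) * normal_tail x"
    using hC by (simp add: algebra_simps)
  have "normal_tail x - normal_tail (x + h) \<le> ?C * (x + h - x)"
    unfolding normal_tail_diff[of x "x + h", simplified, OF h(1)]
    by (rule measure_std_normal_interval(1)) (use h in \<open>auto intro: dens\<close>)
  then show "(1 - exp 3 * (h * (1 + \<bar>x\<bar>))) * normal_tail x \<le> normal_tail (x + h)"
    using hC by (simp add: algebra_simps)
qed

section \<open>Moderate deviations of bounded i.i.d. sums\<close>

text \<open>This converts absolute errors into relative ones on the whole range. The tail at
  \<open>c * sqrt (ln n)\<close> has order n^(-c^2/2) up to constants and a factor sqrt(ln n); the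
  additional power n absorbs both.\<close>

lemma normal_tail_polynomial_lower:
  assumes c: "0 < c"
  shows "\<forall>\<^sub>F n in sequentially. \<forall>x. \<bar>x\<bar> \<le> c * sqrt (ln (real n)) \<longrightarrow>
    1 \<le> normal_tail x * real n powr (c ^ 2 / 2 + 1)"
proof -
  have "\<forall>\<^sub>F n in sequentially. sqrt (2 * pi) * exp (3 / 2) * (1 + c * sqrt (ln (real n))) \<le> real n"
    by real_asymp
  then show ?thesis using eventually_ge_at_top[of 1]
  proof eventually_elim
    case (elim n)
    show ?case
    proof (intro allI impI)
      fix x assume x: "\<bar>x\<bar> \<le> c * sqrt (ln (real n))"
      have n: "1 \<le> real n" using elim by simp
      have "x ^ 2 \<le> (c * sqrt (ln (real n))) ^ 2" using x by (metis abs_ge_zero power2_abs power_mono)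
      also have "\<dots> = c ^ 2 * ln (real n)" using n by (simp add: power_mult_distrib)
      finally have "exp (- (c ^ 2 * ln (real n)) / 2) \<le> exp (- (x ^ 2) / 2)" by simp
      then have "1 \<le> exp (- (x ^ 2) / 2) * real n powr (c ^ 2 / 2)"
        using n by (simp add: powr_def exp_add[symmetric])
      then have "1 / sqrt (2 * pi) * 1 \<le> 1 / sqrt (2 * pi) * (exp (- (x ^ 2) / 2) * real n powr (c ^ 2 / 2))"
        by (intro mult_left_mono) auto
      then have "1 / sqrt (2 * pi) \<le> std_normal_density x * real n powr (c ^ 2 / 2)"
        by (simp add: std_normal_density_def)
      then have "exp (- (3 / 2)) * (1 / sqrt (2 * pi)) \<le> exp (- (3 / 2)) * (std_normal_density x * real n powr (c ^ 2 / 2))"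
        by (rule mult_left_mono) simp
      also have "\<dots> \<le> (1 + \<bar>x\<bar>) * normal_tail x * real n powr (c ^ 2 / 2)"
        using mult_right_mono[OF normal_tail_lower, of "real n powr (c ^ 2 / 2)" x] by (simp add: mult_ac)
      also have "\<dots> \<le> (1 + c * sqrt (ln (real n))) * normal_tail x * real n powr (c ^ 2 / 2)"
        using x normal_tail_nonneg by (intro mult_right_mono) auto
      finally have "sqrt (2 * pi) * exp (3 / 2) * (exp (- (3 / 2)) * (1 / sqrt (2 * pi))) \<le>
          sqrt (2 * pi) * exp (3 / 2) * ((1 + c * sqrt (ln (real n))) * normal_tail x * real n powr (c ^ 2 / 2))"
        by (intro mult_left_mono) auto
      moreover have "sqrt (2 * pi) * exp (3 / 2) * (exp (- (3 / 2)) * (1 / sqrt (2 * pi))) = (1::real)"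
        by (simp add: exp_minus)
      ultimately have "1 \<le> sqrt (2 * pi) * exp (3 / 2) * ((1 + c * sqrt (ln (real n))) * normal_tail x * real n powr (c ^ 2 / 2))"
        by (simp only:)
      then have "1 \<le> (sqrt (2 * pi) * exp (3 / 2) * (1 + c * sqrt (ln (real n)))) * (normal_tail x * real n powr (c ^ 2 / 2))"
        by (simp only: mult_ac)
      also have "\<dots> \<le> real n * (normal_tail x * real n powr (c ^ 2 / 2))"
        using elim normal_tail_nonneg by (intro mult_right_mono) auto
      also have "\<dots> = normal_tail x * real n powr (c ^ 2 / 2 + 1)"
        using n by (simp add: powr_add)
      finally show "1 \<le> normal_tail x * real n powr (c ^ 2 / 2 + 1)" .
    qed
  qed
qed

text \<open>The three limits are the requirements on a relative error \<open>e\<close>, a shift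
  \<eta> of the argument and an absolute error \<open>t\<close>.\<close>

lemma unif_rel_equiv_normal_tail:
  fixes P :: "nat \<Rightarrow> real \<Rightarrow> real" and e \<eta> t :: "nat \<Rightarrow> real"
  assumes c: "0 < c"
    and sandwich: "\<forall>\<^sub>F n in sequentially. \<forall>x.
        P n x \<le> (1 + e n) * normal_tail (x - \<eta> n) + t n \<and>
        normal_tail (x + \<eta> n) - e n * normal_tail (x - \<eta> n) - t n \<le> P n x"
    and nonneg: "\<And>n. 0 \<le> e n" "\<And>n. 0 \<le> \<eta> n" "\<And>n. 0 \<le> t n"
    and lim: "e \<longlonglongrightarrow> 0" "(\<lambda>n. \<eta> n * sqrt (ln (real n))) \<longlonglongrightarrow> 0"
      "(\<lambda>n. t n * real n powr (c ^ 2 / 2 + 1)) \<longlonglongrightarrow> 0"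
  shows "unif_rel_equiv P (\<lambda>n. normal_tail) (\<lambda>n. {- A..c * sqrt (ln (real n))})"
proof -
  define L where "L n = c * sqrt (ln (real n))" for n
  define g where "g n = exp 3 * (\<eta> n * (1 + L n))" for n
  \<comment> \<open>The first three terms are \<open>(1 + e n) * (1 + g n) - 1\<close>, where
    \<open>g\<close> is the relative cost of the shift; the last is the absolute error measured
    against the smallest tail in the range.\<close>
  define u where "u n = g n + e n + e n * g n + t n * real n powr (c ^ 2 / 2 + 1)" for n
  \<comment> \<open>Once \<open>A \<le> L n\<close>, the left end of the range satisfies
    \<open>\<bar>x\<bar> \<le> L n\<close> as well, so negative \<open>x\<close> needs no separate
    treatment.\<close>
  have eL: "\<forall>\<^sub>F n in sequentially. A \<le> L n" "\<forall>\<^sub>F n in sequentially. 1 \<le> L n"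
    unfolding L_def using c by real_asymp+
  have s1: "\<forall>\<^sub>F n in sequentially. 1 \<le> sqrt (ln (real n))" by real_asymp
  have \<eta>0: "\<eta> \<longlonglongrightarrow> 0"
  proof (rule tendsto_sandwich[OF _ _ tendsto_const lim(2)])
    show "\<forall>\<^sub>F n in sequentially. \<eta> n \<le> \<eta> n * sqrt (ln (real n))"
      using s1 by eventually_elim (metis mult_left_mono mult.right_neutral nonneg(2))
  qed (use nonneg in auto)
  have L\<eta>: "(\<lambda>n. L n * \<eta> n) \<longlonglongrightarrow> 0"
    using tendsto_mult[OF tendsto_const[of c] lim(2)] by (simp add: L_def mult_ac)
  have "(\<lambda>n. exp 3 * (\<eta> n + L n * \<eta> n)) \<longlonglongrightarrow> exp 3 * (0 + 0)"
    by (intro tendsto_intros \<eta>0 L\<eta>)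
  then have g0: "g \<longlonglongrightarrow> 0" by (simp add: g_def[abs_def] algebra_simps)
  have "u \<longlonglongrightarrow> 0 + 0 + 0 * 0 + 0"
    unfolding u_def[abs_def] by (intro tendsto_intros g0 lim(1) lim(3))
  then have u0: "u \<longlonglongrightarrow> 0" by simp
  have "\<forall>\<^sub>F n in sequentially. L n * \<eta> n < 1"
    using L\<eta> by (rule order_tendstoD) simp
  then have bound: "\<forall>\<^sub>F n in sequentially. \<forall>x\<in>{- A..L n}. \<bar>P n x / normal_tail x - 1\<bar> \<le> u n"
    using eL normal_tail_polynomial_lower[OF c] sandwich
  proof eventually_elim
    case (elim n)
    show ?case
    proof
      fix x assume x: "x \<in> {- A..L n}"
      define Q where "Q = real n powr (c ^ 2 / 2 + 1)"
      define N where "N = normal_tail x"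
      have N: "0 < N" by (simp add: N_def normal_tail_pos)
      have xL: "\<bar>x\<bar> \<le> L n" using x elim by auto
      have "\<bar>x\<bar> * \<eta> n \<le> L n * \<eta> n" using xL nonneg by (intro mult_right_mono) auto
      then have x\<eta>: "\<bar>x\<bar> * \<eta> n \<le> 1" using elim by simp
      have g: "exp 3 * (\<eta> n * (1 + \<bar>x\<bar>)) \<le> g n"
        unfolding g_def using xL nonneg by (intro mult_left_mono) auto
      have up: "normal_tail (x - \<eta> n) \<le> (1 + g n) * N"
        using normal_tail_shift(1)[OF nonneg(2) x\<eta>] mult_right_mono[OF g, of N] N
        by (simp add: N_def algebra_simps)
      have lo: "(1 - g n) * N \<le> normal_tail (x + \<eta> n)"
        using normal_tail_shift(2)[OF nonneg(2) x\<eta>] mult_right_mono[OF g, of N] N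
        by (simp add: N_def algebra_simps)
      have "1 \<le> N * Q" using elim xL by (simp add: N_def Q_def L_def)
      then have t: "t n \<le> t n * Q * N" using mult_left_mono[OF _ nonneg(3)[of n]] by (metis mult.right_neutral mult.assoc mult.commute)
      have P: "P n x \<le> (1 + e n) * normal_tail (x - \<eta> n) + t n"
        "normal_tail (x + \<eta> n) - e n * normal_tail (x - \<eta> n) - t n \<le> P n x"
        using elim by auto
      have "(1 + e n) * normal_tail (x - \<eta> n) \<le> (1 + e n) * ((1 + g n) * N)"
        using up nonneg(1)[of n] by (intro mult_left_mono) auto
      then have 1: "P n x \<le> (1 + u n) * N"
        using P(1) t by (simp add: u_def Q_def algebra_simps)
      have "e n * normal_tail (x - \<eta> n) \<le> e n * ((1 + g n) * N)"
        using up nonneg(1)[of n] by (intro mult_left_mono) auto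
      then have 2: "(1 - u n) * N \<le> P n x"
        using P(2) t lo by (simp add: u_def Q_def algebra_simps)
      have "P n x / N \<le> 1 + u n" "1 - u n \<le> P n x / N"
        using 1 2 N by (simp_all add: pos_divide_le_eq pos_le_divide_eq)
      then show "\<bar>P n x / normal_tail x - 1\<bar> \<le> u n" by (auto simp: N_def abs_le_iff)
    qed
  qed
  show ?thesis
    unfolding unif_rel_equiv_def L_def[symmetric]
  proof (intro exI[of _ "\<lambda>n x. P n x / normal_tail x - 1"] conjI allI impI)
    show "\<forall>\<^sub>F n in sequentially. \<forall>x\<in>{- A..L n}. P n x = normal_tail x * (1 + (P n x / normal_tail x - 1))"
      using normal_tail_pos by (intro always_eventually allI ballI) (simp add: less_imp_neq[symmetric])
    fix d :: real assume "0 < d"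
    with u0 have "\<forall>\<^sub>F n in sequentially. u n < d" by (rule order_tendstoD)
    with bound show "\<forall>\<^sub>F n in sequentially. \<forall>x\<in>{- A..L n}. \<bar>P n x / normal_tail x - 1\<bar> < d"
      by eventually_elim force
  qed
qed

text \<open>\<open>Y\<close> is a triangular array because the Winsorization levels vary with
  \<open>n\<close>. The distance \<open>d\<close> becomes a shift of the argument, and the
  exceptional probability \<open>p\<close> becomes an absolute error.\<close>

theorem (in prob_space) moderate_deviations_perturbed:
  fixes Y :: "nat \<Rightarrow> nat \<Rightarrow> 'a \<Rightarrow> real" and V :: "nat \<Rightarrow> 'a \<Rightarrow> real" and d p :: "nat \<Rightarrow> real"
  assumes c: "0 < c" and K: "0 \<le> K"
    and Y: "\<forall>\<^sub>F n in sequentially. indep_vars (\<lambda>_. borel) (Y n) {1..n} \<and>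
        (\<forall>i\<in>{1..n}. distr M borel (Y n i) = distr M borel (Y n 1)) \<and>
        (AE \<omega> in M. \<bar>Y n 1 \<omega>\<bar> \<le> K) \<and>
        expectation (Y n 1) = 0 \<and> expectation (\<lambda>\<omega>. Y n 1 \<omega> ^ 2) = 1"
    and V: "\<And>n. random_variable borel (V n)"
    and close: "\<forall>\<^sub>F n in sequentially.
        \<exists>E\<in>events. prob E \<le> p n \<and>
          (\<forall>\<omega>\<in>space M - E. \<bar>V n \<omega> - (\<Sum>i=1..n. Y n i \<omega>) / sqrt (real n)\<bar> < d n)"
    and nonneg: "\<And>n. 0 \<le> d n" "\<And>n. 0 \<le> p n"
    and lim: "(\<lambda>n. d n * sqrt (ln (real n))) \<longlonglongrightarrow> 0"
      "(\<lambda>n. p n * real n powr (c ^ 2 / 2 + 1)) \<longlonglongrightarrow> 0"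
  shows "unif_rel_equiv (\<lambda>n x. prob {\<omega>\<in>space M. V n \<omega> > x}) (\<lambda>n. normal_tail)
    (\<lambda>n. {- A..c * sqrt (ln (real n))})"
proof -
  define Q where "Q = c ^ 2 / 2 + 1"
  have Q: "0 < Q" unfolding Q_def by (simp add: add_nonneg_pos)
  \<comment> \<open>\<open>e n ^ Suc r\<close> is of order n^(-(r+1)/4), which beats n^(-Q) as soon
    as r + 1 > 4 Q.\<close>
  obtain r :: nat where r: "4 * Q < real r" using reals_Archimedean2 by blast
  \<comment> \<open>Chosen so that 5 (2 q + 3) / 12 exceeds Q + 1, the condition for
    \<open>t n\<close> to beat n^(-Q).\<close>
  obtain q :: nat where q: "2 * (Q + 1) < real q" using reals_Archimedean2 by blast
  \<comment> \<open>A scale n^(-s) must satisfy s > 0, to make the shift o(1 / sqrt(ln n)), and s <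
    1/6, to make the relative error n^(3 s - 1/2) vanish; 1/12 is the midpoint.\<close>
  define \<delta> where "\<delta> n = real n powr (- (1 / 12))" for n
  define e where "e n = 4 / 3 * (K ^ 3 + 2) * real n powr (- (1 / 4))" for n
  define t where "t n = 4 / 3 * 2 ^ Suc q * fact (Suc q) * real n powr (1 - 5 / 12 * real (2 * q + 3))" for n
  define \<eta> where "\<eta> n = 5 * real (Suc r) * \<delta> n" for n
  define S where "S n \<omega> = (\<Sum>i=1..n. Y n i \<omega>) / sqrt (real n)" for n \<omega>
  have e0: "0 \<le> e n" for n using K by (simp add: e_def)
  have t0: "0 \<le> t n" for n by (simp add: t_def)
  have \<eta>0: "0 \<le> \<eta> n" for n by (simp add: \<eta>_def \<delta>_def)
  have elim0: "e \<longlonglongrightarrow> 0" unfolding e_def by real_asymp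
  then have "\<forall>\<^sub>F n in sequentially. e n < 1 / 2" by (rule order_tendstoD) simp
  moreover have "\<forall>\<^sub>F n in sequentially. K \<le> sqrt (real n) * \<delta> n" unfolding \<delta>_def by real_asymp
  ultimately have sandwich: "\<forall>\<^sub>F n in sequentially. \<forall>x.
        prob {\<omega>\<in>space M. V n \<omega> > x} \<le> (1 + 2 * e n) * normal_tail (x - (\<eta> n + d n)) + (2 * t n + e n ^ Suc r + p n) \<and>
        normal_tail (x + (\<eta> n + d n)) - 2 * e n * normal_tail (x - (\<eta> n + d n)) - (2 * t n + e n ^ Suc r + p n)
          \<le> prob {\<omega>\<in>space M. V n \<omega> > x}"
    using Y close eventually_ge_at_top[of 1]
  proof eventually_elim
    case (elim n)
    then have n: "1 \<le> n" by simp
    then have \<delta>: "0 < \<delta> n" by (simp add: \<delta>_def)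
    have rv: "random_variable borel (Y n i)" if "i \<in> {1..n}" for i
      using elim that unfolding indep_vars_def by blast
    then have S: "random_variable borel (S n)" unfolding S_def by measurable
    have sqrt: "sqrt (real n) = real n powr (1 / 2)" by (simp add: powr_half_sqrt)
    have pp: "(real n powr a) ^ j = real n powr (a * real j)" for a j
      using n by (simp add: powr_power mult.commute)
    have e: "e n = 4 / 3 * (K ^ 3 + 2) / (sqrt (real n) * \<delta> n ^ 3)"
    proof -
      have "sqrt (real n) * \<delta> n ^ 3 = real n powr (1 / 2 + - (1 / 12) * real 3)"
        unfolding sqrt \<delta>_def pp powr_add ..
      also have "1 / 2 + - (1 / 12) * real 3 = 1 / 4" by simp
      finally show ?thesis unfolding e_def powr_minus divide_inverse by (simp only:)
    qed
    have t: "t n = 4 / 3 * 2 ^ Suc q * fact (Suc q) * real n / (sqrt (real n) * \<delta> n) ^ (2 * q + 3)"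
    proof -
      have "sqrt (real n) * \<delta> n = real n powr (1 / 2 + - (1 / 12))"
        unfolding sqrt \<delta>_def powr_add ..
      also have "1 / 2 + - (1 / 12) = (5 / 12 :: real)" by simp
      finally have *: "(sqrt (real n) * \<delta> n) ^ (2 * q + 3) = real n powr (5 / 12 * real (2 * q + 3))"
        by (simp only: pp)
      have "real n powr 1 = real n" using n by simp
      then show ?thesis unfolding * t_def powr_diff by (simp only: times_divide_eq_right)
    qed
    have iv: "indep_vars (\<lambda>_. borel) (Y n) {1..n}"
      and id: "\<And>i. i \<in> {1..n} \<Longrightarrow> distr M borel (Y n i) = distr M borel (Y n 1)"
      and bd: "AE \<omega> in M. \<bar>Y n 1 \<omega>\<bar> \<le> K"
      and mean: "expectation (Y n 1) = 0" and var: "expectation (\<lambda>\<omega>. Y n 1 \<omega> ^ 2) = 1"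
      and e2: "2 * e n \<le> 1" and K\<delta>: "K \<le> sqrt (real n) * \<delta> n"
      using elim by (blast, blast, blast, blast, blast, linarith, blast)
    note * = iid_sum_tail_sandwich[OF n iv id bd K mean var \<delta> K\<delta> e e2 t \<eta>_def[of n] normal_tail_def refl,
        folded S_def]
    obtain E where E: "E \<in> events" "prob E \<le> p n"
      "\<And>\<omega>. \<omega> \<in> space M \<Longrightarrow> \<omega> \<notin> E \<Longrightarrow> \<bar>V n \<omega> - S n \<omega>\<bar> < d n"
      using elim unfolding S_def by blast
    note [measurable] = S V E(1)
    show ?case
    proof (intro allI conjI)
      fix x
      have "prob {\<omega>\<in>space M. V n \<omega> > x} \<le> prob ({\<omega>\<in>space M. x - d n \<le> S n \<omega>} \<union> E)"
        by (intro finite_measure_mono) (use E(3) in \<open>force+\<close>)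
      also have "\<dots> \<le> prob {\<omega>\<in>space M. x - d n \<le> S n \<omega>} + prob E"
        by (intro measure_Un_le) measurable
      finally show "prob {\<omega>\<in>space M. V n \<omega> > x} \<le> (1 + 2 * e n) * normal_tail (x - (\<eta> n + d n)) + (2 * t n + e n ^ Suc r + p n)"
        using *(1)[of "x - d n"] E(2) by (simp add: algebra_simps)
      \<comment> \<open>The strict bound \<open>< d n\<close> in \<open>close\<close> pays off here:
        from \<open>x + d n \<le> S n \<omega>\<close> it yields the strict inequality
        \<open>V n \<omega> > x\<close>.\<close>
      have "prob {\<omega>\<in>space M. x + d n \<le> S n \<omega>} \<le> prob ({\<omega>\<in>space M. V n \<omega> > x} \<union> E)"
        by (intro finite_measure_mono) (use E(3) in \<open>force+\<close>)
      also have "\<dots> \<le> prob {\<omega>\<in>space M. V n \<omega> > x} + prob E"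
        by (intro measure_Un_le) measurable
      \<comment> \<open>Enlarging this error term to the tail at \<open>x - (\<eta> n + d n)\<close>
        lets one combined shift appear throughout.\<close>
      moreover have "e n * normal_tail (x + d n - \<eta> n) \<le> e n * normal_tail (x - (\<eta> n + d n))"
        using e0 nonneg by (intro mult_left_mono normal_tail_mono) auto
      ultimately show "normal_tail (x + (\<eta> n + d n)) - 2 * e n * normal_tail (x - (\<eta> n + d n)) - (2 * t n + e n ^ Suc r + p n)
          \<le> prob {\<omega>\<in>space M. V n \<omega> > x}"
        using *(2)[of "x + d n"] E(2) by (simp add: algebra_simps)
    qed
  qed
  show ?thesis
  proof (rule unif_rel_equiv_normal_tail[where \<eta> = "\<lambda>n. \<eta> n + d n" and e = "\<lambda>n. 2 * e n"
        and t = "\<lambda>n. 2 * t n + e n ^ Suc r + p n", OF c])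
    show "(\<lambda>n. 2 * e n) \<longlonglongrightarrow> 0" using tendsto_mult[OF tendsto_const elim0, of 2] by simp
    have "(\<lambda>n. \<eta> n * sqrt (ln (real n))) \<longlonglongrightarrow> 0" unfolding \<eta>_def \<delta>_def by real_asymp
    from tendsto_add[OF this lim(1)]
    show "(\<lambda>n. (\<eta> n + d n) * sqrt (ln (real n))) \<longlonglongrightarrow> 0" by (simp add: algebra_simps)
    have "(\<lambda>n. t n * real n powr Q) \<longlonglongrightarrow> 0"
    proof -
      have "1 - 5 / 12 * real (2 * q + 3) + Q < 0" using q Q by (simp add: field_simps)
      then have "(\<lambda>n. (4 / 3 * 2 ^ Suc q * fact (Suc q)) * real n powr (1 - 5 / 12 * real (2 * q + 3) + Q)) \<longlonglongrightarrow>
          (4 / 3 * 2 ^ Suc q * fact (Suc q)) * 0"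
        by (intro tendsto_mult tendsto_const tendsto_neg_powr filterlim_real_sequentially)
      then show ?thesis unfolding t_def powr_add by (simp add: mult.assoc del: of_nat_add)
    qed
    moreover have "(\<lambda>n. e n ^ Suc r * real n powr Q) \<longlonglongrightarrow> 0"
    proof -
      have "- (1 / 4) * real (Suc r) + Q < 0" using r by simp
      then have *: "(\<lambda>n. (4 / 3 * (K ^ 3 + 2)) ^ Suc r * real n powr (- (1 / 4) * real (Suc r) + Q)) \<longlonglongrightarrow>
          (4 / 3 * (K ^ 3 + 2)) ^ Suc r * 0"
        by (intro tendsto_mult tendsto_const tendsto_neg_powr filterlim_real_sequentially)
      have "\<forall>\<^sub>F n in sequentially. (4 / 3 * (K ^ 3 + 2)) ^ Suc r * real n powr (- (1 / 4) * real (Suc r) + Q) = e n ^ Suc r * real n powr Q"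
        using eventually_gt_at_top[of 0]
        by eventually_elim (simp only: e_def powr_add power_mult_distrib powr_power mult.assoc, simp)
      with * show ?thesis by (simp add: tendsto_cong)
    qed
    ultimately have "(\<lambda>n. 2 * (t n * real n powr Q) + e n ^ Suc r * real n powr Q + p n * real n powr Q) \<longlonglongrightarrow> 2 * 0 + 0 + 0"
      using lim(2) unfolding Q_def[symmetric] by (intro tendsto_add tendsto_mult tendsto_const)
    then show "(\<lambda>n. (2 * t n + e n ^ Suc r + p n) * real n powr (c ^ 2 / 2 + 1)) \<longlonglongrightarrow> 0"
      unfolding Q_def[symmetric] by (simp add: algebra_simps)
  qed (use sandwich e0 t0 \<eta>0 nonneg in auto)
qed

section \<open>Order statistics\<close>

text \<open>Sorting only permutes the sample. Taking \<open>f\<close> to be an indicator or a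
  positive part transfers counts and positive parts between the two orderings.\<close>

lemma sum_order_stat_transform:
  "(\<Sum>i=1..n. f (order_stat X n i \<omega>)) = (\<Sum>j=1..n. f (X j \<omega>) :: real)"
proof -
  define xs where "xs = map (\<lambda>j. X j \<omega>) [1..<Suc n]"
  have len: "length xs = n" by (simp add: xs_def)
  have "(\<Sum>j=1..n. f (X j \<omega>)) = (\<Sum>j\<leftarrow>[1..<Suc n]. f (X j \<omega>))"
    by (simp add: interv_sum_list_conv_sum_set_nat atLeastLessThanSuc_atLeastAtMost del: upt_Suc)
  also have "\<dots> = sum_list (map f xs)" by (simp add: xs_def comp_def)
  also have "\<dots> = sum_list (map f (sort xs))"
    by (metis mset_map mset_sort sum_mset_sum_list)
  also have "\<dots> = (\<Sum>i<n. f (sort xs ! i))"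
    by (simp add: sum_list_sum_nth len atLeast0LessThan)
  also have "\<dots> = (\<Sum>i=1..n. f (sort xs ! (i - 1)))"
    by (rule sum.reindex_bij_witness[of _ "\<lambda>i. i - 1" Suc]) auto
  finally show ?thesis by (simp add: order_stat_def xs_def)
qed

lemma order_stat_mono:
  "1 \<le> i \<Longrightarrow> i \<le> j \<Longrightarrow> j \<le> n \<Longrightarrow> order_stat X n i \<omega> \<le> order_stat X n j \<omega>"
  unfolding order_stat_def by (rule sorted_nth_mono) (auto simp del: upt_Suc)

lemma order_stat_le_iff:
  assumes l: "1 \<le> l" "l \<le> n"
  shows "order_stat X n l \<omega> \<le> h \<longleftrightarrow> real l \<le> (\<Sum>j=1..n. indicator {..h} (X j \<omega>))"
proof
  assume *: "order_stat X n l \<omega> \<le> h"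
  have "real l = (\<Sum>i=1..l. indicator {..h} (order_stat X n i \<omega>))"
    using order_stat_mono[OF _ _ l(2), of _ X \<omega>] * by (subst sum.cong[OF refl, of _ _ "\<lambda>_. 1"]) (force simp: indicator_def)+
  also have "\<dots> \<le> (\<Sum>i=1..n. indicator {..h} (order_stat X n i \<omega>))"
    using l by (intro sum_mono2) auto
  finally show "real l \<le> (\<Sum>j=1..n. indicator {..h} (X j \<omega>))"
    by (simp only: sum_order_stat_transform)
next
  assume *: "real l \<le> (\<Sum>j=1..n. indicator {..h} (X j \<omega>))"
  show "order_stat X n l \<omega> \<le> h"
  proof (rule ccontr)
    assume "\<not> ?thesis"
    then have "h < order_stat X n i \<omega>" if "l \<le> i" "i \<le> n" for i
      using order_stat_mono[OF l(1) that, of X \<omega>] by simp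
    then have "(\<Sum>i=1..n. indicator {..h} (order_stat X n i \<omega>)) \<le> (\<Sum>i=1..n. indicator {1..<l} i :: real)"
      by (intro sum_mono) (auto simp: indicator_def not_less not_le[symmetric])
    also have "\<dots> = (\<Sum>i\<in>{1..<l}. 1)"
      using l by (intro sum.mono_neutral_cong_right) auto
    also have "\<dots> = real (l - 1)" by simp
    finally show False using * l unfolding sum_order_stat_transform by simp
  qed
qed

text \<open>Ties are possible, so the lower bound counts strictly smaller observations, while the
  upper bound in \<open>order_stat_le_iff\<close> counts weakly smaller ones.\<close>

lemma order_stat_ge:
  assumes l: "1 \<le> l" "l \<le> n" and *: "(\<Sum>j=1..n. indicator {..<h} (X j \<omega>)) < real l"
  shows "h \<le> order_stat X n l \<omega>"
proof (rule ccontr)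
  assume "\<not> ?thesis"
  then have "real l \<le> (\<Sum>j=1..n. indicator {..order_stat X n l \<omega>} (X j \<omega>))"
    and "order_stat X n l \<omega> < h"
    using order_stat_le_iff[OF l, of X \<omega> "order_stat X n l \<omega>"] by auto
  moreover have "(\<Sum>j=1..n. indicator {..order_stat X n l \<omega>} (X j \<omega>)) \<le> (\<Sum>j=1..n. indicator {..<h} (X j \<omega>) :: real)"
    using \<open>order_stat X n l \<omega> < h\<close> by (intro sum_mono) (auto simp: indicator_def)
  ultimately show False using * by simp
qed

lemma order_stat_measurable:
  assumes l: "1 \<le> l" "l \<le> n" and X: "\<And>j. j \<in> {1..n} \<Longrightarrow> X j \<in> borel_measurable M"
  shows "order_stat X n l \<in> borel_measurable M"
proof (rule borel_measurable_iff_le[THEN iffD2], rule allI)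
  fix h
  note [measurable] = X
  have "{\<omega> \<in> space M. real l \<le> (\<Sum>j=1..n. indicator {..h} (X j \<omega>))} \<in> sets M"
    by measurable
  then show "{\<omega> \<in> space M. order_stat X n l \<omega> \<le> h} \<in> sets M"
    by (simp only: order_stat_le_iff[OF l])
qed

text \<open>The positive part equals the difference for the first \<open>l\<close> order statistics
  and vanishes for the later ones; ties at the \<open>l\<close>-th value contribute 0 on either
  side.\<close>

lemma sum_order_stat_eq:
  assumes l: "1 \<le> l" "l \<le> n"
  shows "(\<Sum>i=1..l. order_stat X n i \<omega>) =
    real l * order_stat X n l \<omega> - (\<Sum>j=1..n. max 0 (order_stat X n l \<omega> - X j \<omega>))"
proof -
  define \<theta> where "\<theta> = order_stat X n l \<omega>"
  have "(\<Sum>j=1..n. max 0 (\<theta> - X j \<omega>)) = (\<Sum>i=1..n. max 0 (\<theta> - order_stat X n i \<omega>))"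
    by (rule sum_order_stat_transform[symmetric])
  also have "\<dots> = (\<Sum>i=1..l. max 0 (\<theta> - order_stat X n i \<omega>))"
    using l order_stat_mono[OF l(1), of _ n X \<omega>]
    by (intro sum.mono_neutral_right) (auto simp: \<theta>_def not_le)
  also have "\<dots> = (\<Sum>i=1..l. \<theta> - order_stat X n i \<omega>)"
    using order_stat_mono[OF _ _ l(2), of _ X \<omega>] by (intro sum.cong) (auto simp: \<theta>_def max_def)
  also have "\<dots> = real l * \<theta> - (\<Sum>i=1..l. order_stat X n i \<omega>)"
    by (simp add: sum_subtractf)
  finally show ?thesis unfolding \<theta>_def by simp
qed

text \<open>The error in replacing the sum of the \<open>l\<close> smallest observations by
  \<open>l * \<xi> - (\<Sum>j=1..n. max 0 (\<xi> - X j \<omega>))\<close>, a sum of i.i.d.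
  terms.\<close>

definition trimming_gap :: "(nat \<Rightarrow> 'a \<Rightarrow> real) \<Rightarrow> nat \<Rightarrow> nat \<Rightarrow> real \<Rightarrow> 'a \<Rightarrow> real" where
  "trimming_gap X n l \<xi> \<omega> =
     (\<Sum>j=1..n. max 0 (\<xi> - X j \<omega>)) - (\<Sum>i=1..l. \<xi> - order_stat X n i \<omega>)"

lemma trimming_gap_nonneg:
  assumes "l \<le> n"
  shows "0 \<le> trimming_gap X n l \<xi> \<omega>"
proof -
  have "(\<Sum>i=1..l. \<xi> - order_stat X n i \<omega>) \<le> (\<Sum>i=1..l. max 0 (\<xi> - order_stat X n i \<omega>))"
    by (intro sum_mono) simp
  also have "\<dots> \<le> (\<Sum>i=1..n. max 0 (\<xi> - order_stat X n i \<omega>))"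
    using assms by (intro sum_mono2) auto
  also have "\<dots> = (\<Sum>j=1..n. max 0 (\<xi> - X j \<omega>))" by (rule sum_order_stat_transform)
  finally show ?thesis unfolding trimming_gap_def by simp
qed

text \<open>The sum of the \<open>l\<close> smallest observations is the value at \<open>\<theta> = X\<^bsub>l:n\<^esub>\<close> of the concave function
  \<open>l * \<theta> - (\<Sum>j. max 0 (\<theta> - X j))\<close>; the gap compares this maximum with the value at \<open>\<xi>\<close>, and the
  slope in between is controlled by the counts at \<open>\<xi>\<close>.\<close>
lemma trimming_gap_le:
  assumes l: "1 \<le> l" "l \<le> n"
    and hi: "real l \<le> (\<Sum>j=1..n. indicator {..hi} (X j \<omega>))"
    and lo: "(\<Sum>j=1..n. indicator {..<lo} (X j \<omega>)) < real l"
    and w: "real l - w \<le> (\<Sum>j=1..n. indicator {..\<xi>} (X j \<omega>))"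
      "(\<Sum>j=1..n. indicator {..<\<xi>} (X j \<omega>)) \<le> real l + w" "0 \<le> w"
  shows "trimming_gap X n l \<xi> \<omega> \<le> w * (\<bar>hi - \<xi>\<bar> + \<bar>lo - \<xi>\<bar>)"
proof -
  define \<theta> where "\<theta> = order_stat X n l \<omega>"
  have \<theta>: "lo \<le> \<theta>" "\<theta> \<le> hi"
    using order_stat_le_iff[OF l, of X \<omega> hi] order_stat_ge[OF l, where X=X and \<omega>=\<omega> and h=lo] hi lo by (simp_all add: \<theta>_def)
  have gap: "trimming_gap X n l \<xi> \<omega> =
      real l * (\<theta> - \<xi>) - (\<Sum>j=1..n. max 0 (\<theta> - X j \<omega>) - max 0 (\<xi> - X j \<omega>))"
    unfolding trimming_gap_def sum_subtractf sum_order_stat_eq[OF l] \<theta>_def by (simp add: algebra_simps)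
  show ?thesis
  proof (cases "\<xi> \<le> \<theta>")
    case True
    \<comment> \<open>Each observation up to \<xi> contributes exactly
      \<open>\<theta> - \<xi>\<close>, and the others contribute at least 0. The opposite case is
      the mirror image, with an open half-line.\<close>
    have "(\<theta> - \<xi>) * (\<Sum>j=1..n. indicator {..\<xi>} (X j \<omega>)) \<le> (\<Sum>j=1..n. max 0 (\<theta> - X j \<omega>) - max 0 (\<xi> - X j \<omega>))"
      unfolding sum_distrib_left using True by (intro sum_mono) (auto simp: indicator_def)
    then have "trimming_gap X n l \<xi> \<omega> \<le> (\<theta> - \<xi>) * (real l - (\<Sum>j=1..n. indicator {..\<xi>} (X j \<omega>)))"
      unfolding gap by (simp add: algebra_simps)
    also have "\<dots> \<le> (\<theta> - \<xi>) * w" using w True by (intro mult_left_mono) auto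
    also have "\<dots> \<le> (\<bar>hi - \<xi>\<bar> + \<bar>lo - \<xi>\<bar>) * w" using w \<theta> by (intro mult_right_mono) auto
    finally show ?thesis by (simp add: mult.commute)
  next
    case False
    have "(\<Sum>j=1..n. max 0 (\<xi> - X j \<omega>) - max 0 (\<theta> - X j \<omega>)) \<le> (\<xi> - \<theta>) * (\<Sum>j=1..n. indicator {..<\<xi>} (X j \<omega>))"
      unfolding sum_distrib_left using False by (intro sum_mono) (auto simp: indicator_def)
    then have "trimming_gap X n l \<xi> \<omega> \<le> (\<xi> - \<theta>) * ((\<Sum>j=1..n. indicator {..<\<xi>} (X j \<omega>)) - real l)"
      unfolding gap sum_subtractf by (simp add: algebra_simps)
    also have "\<dots> \<le> (\<xi> - \<theta>) * w" using w False by (intro mult_left_mono) auto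
    also have "\<dots> \<le> (\<bar>hi - \<xi>\<bar> + \<bar>lo - \<xi>\<bar>) * w" using w \<theta> by (intro mult_right_mono) auto
    finally show ?thesis by (simp add: mult.commute)
  qed
qed

section \<open>The trimmed mean as a Winsorized sum plus two gaps\<close>

lemma winsorize_eq: "a \<le> b \<Longrightarrow> winsorize a b x = b - max 0 (b - x) + max 0 (a - x)"
  by (auto simp: winsorize_def)

text \<open>The trimmed sum is a difference of two sums of smallest observations. Linearizing the
  longer one at \<open>b\<close> and the shorter one at \<open>a\<close> makes the positive parts
  combine into the Winsorized sum. The upper end thus also uses smallest observations, and no
  reflection of the sample occurs.\<close>

lemma trimmed_mean_decomposition:
  assumes "k + m < n" "a \<le> b"
  shows "real n * trimmed_mean X k m n \<omega> =
    (\<Sum>j=1..n. winsorize a b (X j \<omega>)) - real k * a - real m * b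
      + (trimming_gap X n (n - m) b \<omega> - trimming_gap X n k a \<omega>)"
proof -
  let ?S = "\<lambda>l. \<Sum>i=1..l. order_stat X n i \<omega>"
  have split: "{1..n - m} = {1..k} \<union> {k + 1..n - m}" using assms by auto
  have "?S (n - m) = ?S k + (\<Sum>i=k + 1..n - m. order_stat X n i \<omega>)"
    unfolding split by (intro sum.union_disjoint) auto
  then have T: "real n * trimmed_mean X k m n \<omega> = ?S (n - m) - ?S k"
    using assms by (simp add: trimmed_mean_def)
  have W: "(\<Sum>j=1..n. winsorize a b (X j \<omega>)) =
      real n * b - (\<Sum>j=1..n. max 0 (b - X j \<omega>)) + (\<Sum>j=1..n. max 0 (a - X j \<omega>))"
    by (simp add: winsorize_eq assms sum.distrib sum_subtractf)
  have "real (n - m) = real n - real m" using assms by simp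
  then show ?thesis
    unfolding T W trimming_gap_def by (simp add: sum_subtractf algebra_simps)
qed

section \<open>Quantiles and concentration of the trimming gap\<close>

lemma quantile_le_iff:
  assumes "real_distribution D" "0 < u" "u < 1"
  shows "quantile (cdf D) u \<le> x \<longleftrightarrow> u \<le> cdf D x"
proof -
  interpret cdf_distribution D using assms(1) by (simp add: cdf_distribution_def)
  show ?thesis using pseudoinverse[OF assms(2,3), of x] assms(2) by (simp add: quantile_def)
qed

lemma quantile_mono:
  assumes D: "real_distribution D" and "0 < u" "u \<le> v" "v < 1"
  shows "quantile (cdf D) u \<le> quantile (cdf D) v"
  using assms(2-) quantile_le_iff[OF D, of v "quantile (cdf D) v"]
  by (subst quantile_le_iff[OF D]) auto

text \<open>Together with \<open>measure_less_quantile\<close> this replaces the identity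
  F(F^{-1}(u)) = u, which an atom can violate.\<close>

lemma measure_le_quantile:
  assumes D: "real_distribution D" and u: "0 < u" "u < 1"
  shows "u \<le> measure D {..quantile (cdf D) u}"
  using quantile_le_iff[OF D u, of "quantile (cdf D) u"] by (simp add: cdf_def)

lemma measure_less_quantile:
  assumes D: "real_distribution D" and u: "0 < u" "u < 1"
  shows "measure D {..<quantile (cdf D) u} \<le> u"
proof -
  interpret real_distribution D by fact
  have "(cdf D \<longlongrightarrow> measure D {..<quantile (cdf D) u}) (at_left (quantile (cdf D) u))"
    by (rule cdf_at_left)
  moreover have "\<forall>\<^sub>F x in at_left (quantile (cdf D) u). cdf D x \<le> u"
    unfolding eventually_at_filter
    using quantile_le_iff[OF D u] by (intro always_eventually) (auto simp: not_le[symmetric])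
  ultimately show ?thesis by (rule tendsto_upperbound) simp
qed

lemma winsorize_range: "a \<le> b \<Longrightarrow> a \<le> winsorize a b x \<and> winsorize a b x \<le> b"
  by (auto simp: winsorize_def)

lemma winsorize_measurable [measurable]: "winsorize a b \<in> borel_measurable borel"
  unfolding winsorize_def[abs_def] by measurable

text \<open>Quantile transform: \<open>I\<close> applied to a uniform variable on (0, 1) has law
  \<open>D\<close>. After Winsorization the integrand is \<open>a\<close> below \<alpha>, the
  quantile function in the middle and \<open>b\<close> above \<open>1 - \<beta>\<close>.\<close>

lemma integral_winsorize_quantile:
  assumes D: "real_distribution D" and \<alpha>: "0 < \<alpha>" "\<alpha> < 1 - \<beta>" and \<beta>: "0 < \<beta>"
  defines "a \<equiv> quantile (cdf D) \<alpha>" and "b \<equiv> quantile (cdf D) (1 - \<beta>)"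
  shows "(\<integral>x. winsorize a b x \<partial>D) = \<alpha> * a + trimmed_center (cdf D) \<alpha> \<beta> + \<beta> * b"
proof -
  interpret cdf_distribution D using D by (simp add: cdf_distribution_def)
  let ?R = "restrict_space lborel {0<..<1::real}"
  have q: "I u = quantile (cdf D) u" if "0 < u" for u using that by (simp add: quantile_def)
  have ab: "a \<le> b" unfolding a_def b_def using \<alpha> \<beta> by (intro quantile_mono[OF D]) auto
  have meas: "(\<lambda>u. winsorize a b (I u)) \<in> borel_measurable ?R"
  proof -
    have "I \<in> borel_measurable ?R" using measurable_CI by (simp cong: measurable_cong_sets add: sets_restrict_space)
    then show ?thesis by measurable
  qed
  interpret R: prob_space ?R
    by (auto simp: emeasure_restrict_space space_restrict_space intro!: prob_spaceI)
  define f where "f u = indicator {0<..<1} u * winsorize a b (I u)" for u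
  have "integrable ?R (\<lambda>u. winsorize a b (I u))"
    using winsorize_range[OF ab] by (intro R.integrable_const_bound[of _ "\<bar>a\<bar> + \<bar>b\<bar>"] meas AE_I2) (smt (verit) real_norm_def)
  then have fi: "integrable lborel f"
    unfolding f_def by (subst (asm) integrable_restrict_space) auto
  have "(\<integral>x. winsorize a b x \<partial>D) = (\<integral>x. winsorize a b x \<partial>distr ?R borel I)"
    by (simp only: distr_I_eq_M)
  also have "\<dots> = (\<integral>u. winsorize a b (I u) \<partial>?R)"
  proof (rule integral_distr)
    show "I \<in> measurable ?R borel" using measurable_CI by (simp cong: measurable_cong_sets add: sets_restrict_space)
  qed measurable
  also have "\<dots> = (\<integral>u. f u \<partial>lborel)"
    unfolding f_def by (subst integral_restrict_space) auto
  finally have 1: "(\<integral>x. winsorize a b x \<partial>D) = (\<integral>u. f u \<partial>lborel)" .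
  have h: "has_bochner_integral lborel (\<lambda>u. a * indicator {0<..<\<alpha>} u + b * indicator {1 - \<beta><..<1} u) (a * \<alpha> + b * \<beta>)"
    using \<alpha> \<beta> by (intro has_bochner_integral_add has_bochner_integral_mult_right) (simp_all add: has_bochner_integral_iff)
  have "f u - (a * indicator {0<..<\<alpha>} u + b * indicator {1 - \<beta><..<1} u) =
      indicator {\<alpha>..1 - \<beta>} u * quantile (cdf D) u" for u
  proof -
    consider "u \<le> 0 \<or> 1 \<le> u" | "0 < u" "u < \<alpha>" | "\<alpha> \<le> u" "u \<le> 1 - \<beta>" | "1 - \<beta> < u" "u < 1" by linarith
    then show ?thesis
    proof cases
      case 2
      have "quantile (cdf D) u \<le> a"
        unfolding a_def using 2 \<alpha> \<beta> by (intro quantile_mono[OF D]) auto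
      then show ?thesis using 2 \<alpha> \<beta> by (simp add: f_def q winsorize_def indicator_def)
    next
      case 3
      have "a \<le> quantile (cdf D) u" "quantile (cdf D) u \<le> b"
        unfolding a_def b_def using 3 \<alpha> \<beta> by (auto intro!: quantile_mono[OF D])
      then show ?thesis using 3 \<alpha> \<beta> by (simp add: f_def q winsorize_def indicator_def)
    next
      case 4
      have "b \<le> quantile (cdf D) u"
        unfolding b_def using 4 \<alpha> \<beta> by (intro quantile_mono[OF D]) auto
      then show ?thesis using 4 \<alpha> \<beta> ab by (simp add: f_def q winsorize_def indicator_def)
    qed (use \<alpha> \<beta> in \<open>auto simp: f_def indicator_def\<close>)
  qed
  then have "trimmed_center (cdf D) \<alpha> \<beta> =
      (\<integral>u. f u - (a * indicator {0<..<\<alpha>} u + b * indicator {1 - \<beta><..<1} u) \<partial>lborel)"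
    unfolding trimmed_center_def set_lebesgue_integral_def by simp
  also have "\<dots> = (\<integral>u. f u \<partial>lborel) - (a * \<alpha> + b * \<beta>)"
    using fi integrable.intros[OF h] has_bochner_integral_integral_eq[OF h] by (subst Bochner_Integration.integral_diff) auto
  finally show ?thesis using 1 by simp
qed

section \<open>Concentration and standardization for an i.i.d. sample\<close>

locale iid_sample = prob_space M for M :: "'a measure" +
  fixes X :: "nat \<Rightarrow> 'a \<Rightarrow> real" and D :: "real measure"
  assumes indep: "indep_vars (\<lambda>_. borel) X {1..}"
    and ident: "\<And>i. 1 \<le> i \<Longrightarrow> distr M borel (X i) = D"
begin

lemma rv: "1 \<le> i \<Longrightarrow> random_variable borel (X i)"
  using indep unfolding indep_vars_def by auto

sublocale D: real_distribution D
  using ident[of 1] prob_space_distr[OF rv[of 1]]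
  by (auto simp: real_distribution_def real_distribution_axioms_def)

lemma expectation_eq:
  assumes "1 \<le> i" "(f :: real \<Rightarrow> real) \<in> borel_measurable borel"
  shows "expectation (\<lambda>\<omega>. f (X i \<omega>)) = (\<integral>x. f x \<partial>D)"
  using ident[OF assms(1)] integral_distr[OF rv[OF assms(1)] assms(2)] by simp

lemma count_deviation:
  assumes n: "1 \<le> n" and s: "0 \<le> s" and A: "A \<in> sets borel"
  shows "prob {\<omega>\<in>space M. real n * (measure D A + s) \<le> (\<Sum>j=1..n. indicator A (X j \<omega>))} \<le> exp (- 2 * real n * s ^ 2)"
    and "prob {\<omega>\<in>space M. (\<Sum>j=1..n. indicator A (X j \<omega>)) \<le> real n * (measure D A - s)} \<le> exp (- 2 * real n * s ^ 2)"
proof -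
  note [measurable] = A
  have iv: "indep_vars (\<lambda>_. borel) (\<lambda>j \<omega>. indicator A (X j \<omega>) :: real) {1..n}"
    by (rule indep_vars_compose2[OF indep_vars_subset[OF indep]]) auto
  interpret H: Hoeffding_ineq M "{1..n}" "\<lambda>j \<omega>. indicator A (X j \<omega>)" "\<lambda>_. 0" "\<lambda>_. 1"
      "\<Sum>j\<in>{1..n}. expectation (\<lambda>\<omega>. indicator A (X j \<omega>))"
    by unfold_locales (use iv in \<open>auto simp: indicator_def\<close>)
  have e: "(\<Sum>j\<in>{1..n}. expectation (\<lambda>\<omega>. indicator A (X j \<omega>))) = real n * measure D A"
    by (subst sum.cong[OF refl, of _ _ "\<lambda>_. measure D A"]) (simp_all add: expectation_eq)
  have "- 2 * (real n * s) ^ 2 / real n = - 2 * real n * s ^ 2"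
    using n by (simp add: power2_eq_square)
  then show "prob {\<omega>\<in>space M. real n * (measure D A + s) \<le> (\<Sum>j=1..n. indicator A (X j \<omega>))} \<le> exp (- 2 * real n * s ^ 2)"
    and "prob {\<omega>\<in>space M. (\<Sum>j=1..n. indicator A (X j \<omega>)) \<le> real n * (measure D A - s)} \<le> exp (- 2 * real n * s ^ 2)"
    using H.Hoeffding_ineq_ge[of "real n * s"] H.Hoeffding_ineq_le[of "real n * s"] n s
    unfolding e by (simp_all add: algebra_simps)
qed

text \<open>Four Hoeffding events are excluded. The counts at the quantiles of \<open>p + s\<close>
  and \<open>p - s\<close> locate the \<open>l\<close>-th order statistic between them, and the two
  counts at the quantile of \<open>p\<close> supply the slope bound \<open>real n * s\<close> for
  \<open>trimming_gap_le\<close>.\<close>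

lemma trimming_gap_concentration:
  assumes l: "1 \<le> l" "l \<le> n" and p: "real l = real n * p" and s: "0 < s" "0 < p - s" "p + s < 1"
  shows "\<exists>E\<in>events. prob E \<le> 4 * exp (- 2 * real n * s ^ 2) \<and>
    (\<forall>\<omega>\<in>space M - E. \<bar>trimming_gap X n l (quantile (cdf D) p) \<omega>\<bar> \<le>
      real n * s * (\<bar>quantile (cdf D) (p + s) - quantile (cdf D) p\<bar> + \<bar>quantile (cdf D) (p - s) - quantile (cdf D) p\<bar>))"
proof -
  define Q where "Q = quantile (cdf D)"
  define C where "C A \<omega> = (\<Sum>j=1..n. indicator A (X j \<omega>) :: real)" for A \<omega>
  define U where "U A = {\<omega>\<in>space M. real n * (measure D A + s) \<le> C A \<omega>}" for A
  define L where "L A = {\<omega>\<in>space M. C A \<omega> \<le> real n * (measure D A - s)}" for A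
  have n: "1 \<le> n" using l by simp
  have C_meas: "C A \<in> borel_measurable M" if "A \<in> sets borel" for A
    unfolding C_def using that by (intro borel_measurable_sum measurable_compose[OF rv]) auto
  have ev: "U A \<in> events" "L A \<in> events" if "A \<in> sets borel" for A
    unfolding U_def L_def using C_meas[OF that] by measurable
  have dev: "prob (U A) \<le> exp (- 2 * real n * s ^ 2)" "prob (L A) \<le> exp (- 2 * real n * s ^ 2)" if "A \<in> sets borel" for A
    unfolding U_def L_def C_def using count_deviation[OF n less_imp_le[OF s(1)] that] by auto
  let ?E = "(L {..Q (p + s)} \<union> U {..<Q (p - s)}) \<union> (L {..Q p} \<union> U {..<Q p})"
  show ?thesis
  proof (intro bexI[of _ ?E] conjI ballI)
    show "?E \<in> events" using ev by auto
    have "prob ?E \<le> (prob (L {..Q (p + s)}) + prob (U {..<Q (p - s)})) + (prob (L {..Q p}) + prob (U {..<Q p}))"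
      by (rule order_trans[OF measure_Un_le add_mono[OF measure_Un_le measure_Un_le]]) (use ev in auto)
    also have "\<dots> \<le> 4 * exp (- 2 * real n * s ^ 2)"
      using dev[of "{..Q (p + s)}"] dev[of "{..<Q (p - s)}"] dev[of "{..Q p}"] dev[of "{..<Q p}"] by simp
    finally show "prob ?E \<le> 4 * exp (- 2 * real n * s ^ 2)" .
    fix \<omega> assume \<omega>: "\<omega> \<in> space M - ?E"
    have q: "p + s \<le> measure D {..Q (p + s)}" "measure D {..<Q (p - s)} \<le> p - s"
      "p \<le> measure D {..Q p}" "measure D {..<Q p} \<le> p"
      unfolding Q_def using s by (auto intro!: measure_le_quantile measure_less_quantile D.real_distribution_axioms)
    have nq: "real n * (p + s) \<le> real n * measure D {..Q (p + s)}" "real n * measure D {..<Q (p - s)} \<le> real n * (p - s)"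
      "real n * p \<le> real n * measure D {..Q p}" "real n * measure D {..<Q p} \<le> real n * p"
      using q by (auto intro!: mult_left_mono)
    have "trimming_gap X n l (Q p) \<omega> \<le> (real n * s) * (\<bar>Q (p + s) - Q p\<bar> + \<bar>Q (p - s) - Q p\<bar>)"
      by (rule trimming_gap_le[OF l])
        (use \<omega> nq s in \<open>auto simp: U_def L_def C_def p algebra_simps\<close>)
    then show "\<bar>trimming_gap X n l (quantile (cdf D) p) \<omega>\<bar> \<le>
      real n * s * (\<bar>quantile (cdf D) (p + s) - quantile (cdf D) p\<bar> + \<bar>quantile (cdf D) (p - s) - quantile (cdf D) p\<bar>)"
      using trimming_gap_nonneg[OF l(2), of X "Q p" \<omega>] by (simp add: Q_def)
  qed
qed

lemma trimmed_mean_measurable: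
  "random_variable borel (trimmed_mean X k m n)"
  unfolding trimmed_mean_def[abs_def]
  by (intro borel_measurable_divide borel_measurable_sum order_stat_measurable borel_measurable_const rv) auto

text \<open>The deterministic terms \<open>k * a + m * b\<close> of the decomposition are exactly
  \<open>n\<close> times the contributions of the two flat pieces to the Winsorized expectation, so
  only \<open>trimmed_center\<close> is left as centring.\<close>

lemma trimmed_mean_error:
  assumes km: "k + m < n" "\<alpha> = real k / real n" "\<beta> = real m / real n" and pos: "0 < \<alpha>" "0 < \<beta>"
    and ab: "a = quantile (cdf D) \<alpha>" "b = quantile (cdf D) (1 - \<beta>)"
    and e: "e = expectation (\<lambda>\<omega>. winsorize a b (X 1 \<omega>))"
  shows "real n * (trimmed_mean X k m n \<omega> - trimmed_center (cdf D) \<alpha> \<beta>) =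
    (\<Sum>j=1..n. winsorize a b (X j \<omega>) - e) + (trimming_gap X n (n - m) b \<omega> - trimming_gap X n k a \<omega>)"
proof -
  have n: "0 < real n" using km by simp
  have "\<alpha> + \<beta> = real (k + m) / real n" by (simp add: km add_divide_distrib)
  also have "\<dots> < 1" using km(1) n by simp
  finally have \<alpha>\<beta>: "\<alpha> < 1 - \<beta>" by simp
  have "a \<le> b" unfolding ab using pos \<alpha>\<beta> by (intro quantile_mono D.real_distribution_axioms) auto
  have "real n * \<alpha> = real k" "real n * \<beta> = real m" using n by (simp_all add: km)
  moreover have "e = \<alpha> * a + trimmed_center (cdf D) \<alpha> \<beta> + \<beta> * b"
    unfolding e ab using pos \<alpha>\<beta>
    by (subst expectation_eq) (auto intro!: integral_winsorize_quantile D.real_distribution_axioms)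
  then have "real n * e = real n * \<alpha> * a + real n * trimmed_center (cdf D) \<alpha> \<beta> + real n * \<beta> * b"
    by (simp add: algebra_simps)
  ultimately show ?thesis
    using trimmed_mean_decomposition[OF km(1) \<open>a \<le> b\<close>, of X \<omega>] by (simp add: sum_subtractf algebra_simps)
qed

text \<open>The sign \<open>g\<close> lets one argument serve both tails. The bound holds because
  the Winsorized variable and its expectation both lie between \<open>a\<close> and
  \<open>b\<close>.\<close>

lemma winsorized_standardized:
  assumes ab: "a \<le> b" and sd: "\<sigma> = sqrt (variance (\<lambda>\<omega>. winsorize a b (X 1 \<omega>)))" "0 < \<sigma>"
    and g: "\<bar>g\<bar> = 1"
    and e: "e = expectation (\<lambda>\<omega>. winsorize a b (X 1 \<omega>))"
    and Y: "\<And>i \<omega>. Y i \<omega> = g * (winsorize a b (X i \<omega>) - e) / \<sigma>"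
  shows "indep_vars (\<lambda>_. borel) Y {1..n}"
    and "1 \<le> i \<Longrightarrow> distr M borel (Y i) = distr M borel (Y 1)"
    and "\<bar>Y 1 \<omega>\<bar> \<le> (b - a) / \<sigma>"
    and "expectation (Y 1) = 0" and "expectation (\<lambda>\<omega>. Y 1 \<omega> ^ 2) = 1"
proof -
  note One_nat_def [simp del]
  have Y': "Y i = (\<lambda>\<omega>. g * (winsorize a b (X i \<omega>) - e) / \<sigma>)" for i using Y by blast
  have "indep_vars (\<lambda>_. borel) (\<lambda>i \<omega>. g * (winsorize a b (X i \<omega>) - e) / \<sigma>) {1..n}"
    by (rule indep_vars_compose2[OF indep_vars_subset[OF indep]]) auto
  then show "indep_vars (\<lambda>_. borel) Y {1..n}" by (simp only: Y'[abs_def])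
  have dist: "distr M borel (Y i) = distr D borel (\<lambda>x. g * (winsorize a b x - e) / \<sigma>)" if "1 \<le> i" for i
    unfolding ident[OF that, symmetric] Y' by (subst distr_distr) (use rv[OF that] in \<open>auto simp: comp_def\<close>)
  then show "1 \<le> i \<Longrightarrow> distr M borel (Y i) = distr M borel (Y 1)" by simp
  have rv1 [measurable]: "random_variable borel (X 1)" by (rule rv) simp
  have bd: "a \<le> winsorize a b (X 1 \<omega>)" "winsorize a b (X 1 \<omega>) \<le> b" for \<omega>
    using winsorize_range[OF ab] by auto
  have iW: "integrable M (\<lambda>\<omega>. winsorize a b (X 1 \<omega>))"
    using bd by (intro integrable_const_bound[of _ "\<bar>a\<bar> + \<bar>b\<bar>"] AE_I2) (smt (verit) real_norm_def, measurable)
  have e_bd: "a \<le> e" "e \<le> b"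
    unfolding e using bd iW by (auto intro!: integral_ge_const integral_le_const)
  then have "\<bar>winsorize a b (X 1 \<omega>) - e\<bar> \<le> b - a" using bd[of \<omega>] by linarith
  then show "\<bar>Y 1 \<omega>\<bar> \<le> (b - a) / \<sigma>"
    unfolding Y using g sd(2) by (simp add: abs_mult divide_right_mono)
  show "expectation (Y 1) = 0"
    unfolding Y' using iW prob_space by (simp add: e)
  have g2: "g ^ 2 = 1" using g by (metis one_power2 power2_abs)
  have "expectation (\<lambda>\<omega>. Y 1 \<omega> ^ 2) = expectation (\<lambda>\<omega>. (winsorize a b (X 1 \<omega>) - e) ^ 2 / \<sigma> ^ 2)"
    unfolding Y by (simp add: power_mult_distrib power_divide g2)
  also have "\<dots> = variance (\<lambda>\<omega>. winsorize a b (X 1 \<omega>)) / \<sigma> ^ 2" by (simp add: e)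
  also have "variance (\<lambda>\<omega>. winsorize a b (X 1 \<omega>)) = \<sigma> ^ 2"
  proof -
    have "0 < variance (\<lambda>\<omega>. winsorize a b (X 1 \<omega>))" using sd by simp
    then show ?thesis unfolding sd(1) by simp
  qed
  finally show "expectation (\<lambda>\<omega>. Y 1 \<omega> ^ 2) = 1" using sd(2) by simp
qed

end

section \<open>The trimmed mean\<close>

text \<open>The margin \<kappa> is used twice: it confines both quantiles to a fixed interval, so
  the standardized variables share one bound \<open>K\<close>, and it keeps the Hoeffding exponent
  at the scale of \<open>G_aux\<close> and \<open>H_aux\<close> above a fixed multiple of
  \<open>ln n\<close>.\<close>

lemma (in iid_sample) trimmed_mean_tail:
  fixes k m :: "nat \<Rightarrow> nat" and \<alpha> \<beta> \<sigma> :: "nat \<Rightarrow> real"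
  assumes trim: "\<And>n. 1 \<le> n \<Longrightarrow> k n + m n < n"
    and \<alpha>: "\<And>n. \<alpha> n = real (k n) / real n" and \<beta>: "\<And>n. \<beta> n = real (m n) / real n"
    and \<sigma>: "\<And>n. \<sigma> n = winsorized_sd M (X 1) (cdf D) (\<alpha> n) (\<beta> n)"
    and \<kappa>: "0 < \<kappa>" "\<forall>\<^sub>F n in sequentially. \<kappa> \<le> \<alpha> n" "\<forall>\<^sub>F n in sequentially. \<kappa> \<le> \<beta> n"
    and \<sigma>0: "0 < \<sigma>0" "\<forall>\<^sub>F n in sequentially. \<sigma>0 \<le> \<sigma> n"
    and \<epsilon>: "0 < \<epsilon>"
    and G: "\<And>t. G_aux (cdf D) \<alpha> t \<in> O(\<lambda>n. ln (real n) powr (- (1 + \<epsilon>)))"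
    and H: "\<And>t. H_aux (cdf D) \<beta> t \<in> O(\<lambda>n. ln (real n) powr (- (1 + \<epsilon>)))"
    and g: "\<bar>g\<bar> = 1" and c: "0 < c"
  shows "unif_rel_equiv
    (\<lambda>n x. prob {\<omega>\<in>space M. g * (sqrt (real n) *
        (trimmed_mean X (k n) (m n) n \<omega> - trimmed_center (cdf D) (\<alpha> n) (\<beta> n)) / \<sigma> n) > x})
    (\<lambda>n. normal_tail) (\<lambda>n. {- A..c * sqrt (ln (real n))})"
proof -
  define q where "q = quantile (cdf D)"
  define R where "R n = ln (real n) powr (- (1 + \<epsilon>))" for n
  define Q where "Q = c ^ 2 / 2 + 1"
  have Q: "0 < Q" unfolding Q_def by (simp add: add_nonneg_pos)
  \<comment> \<open>Hoeffding will give probability of order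
    \<open>n powr (- (2 * t ^ 2 * \<kappa>))\<close>, which must beat n^(-Q). With
    \<open>max 1\<close> one has \<open>t \<le> t ^ 2\<close>, so
    \<open>Q \<le> t * \<kappa>\<close> suffices.\<close>
  define t where "t = max 1 (Q / \<kappa>)"
  have t: "1 \<le> t" "Q < 2 * t ^ 2 * \<kappa>"
  proof -
    show "1 \<le> t" by (simp add: t_def)
    have "Q \<le> t * \<kappa>" using \<kappa>(1) by (simp add: t_def pos_divide_le_eq[symmetric])
    also have "\<dots> \<le> t ^ 2 * \<kappa>"
      using \<kappa>(1) \<open>1 \<le> t\<close> by (intro mult_right_mono) (auto simp: power2_eq_square)
    finally show "Q < 2 * t ^ 2 * \<kappa>" using Q by simp
  qed
  obtain C where C: "0 < C" "\<forall>\<^sub>F n in sequentially.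
      \<bar>G_aux (cdf D) \<alpha> t n\<bar> \<le> C * R n \<and> \<bar>G_aux (cdf D) \<alpha> (- t) n\<bar> \<le> C * R n \<and>
      \<bar>H_aux (cdf D) \<beta> t n\<bar> \<le> C * R n \<and> \<bar>H_aux (cdf D) \<beta> (- t) n\<bar> \<le> C * R n"
  proof -
    have R0: "0 \<le> R n" for n by (simp add: R_def)
    have big: "\<exists>C>0. \<forall>\<^sub>F n in sequentially. \<bar>f n\<bar> \<le> C * R n" if f: "f \<in> O(R)" for f
    proof -
      obtain C where "0 < C" and ev: "\<forall>\<^sub>F n in sequentially. norm (f n) \<le> C * norm (R n)"
        using f by (rule landau_o.bigE)
      have "\<forall>\<^sub>F n in sequentially. \<bar>f n\<bar> \<le> C * R n"
        using ev by eventually_elim (use R0 in simp)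
      with \<open>0 < C\<close> show ?thesis by (intro exI[of _ C] conjI)
    qed
    have GR: "G_aux (cdf D) \<alpha> v \<in> O(R)" "H_aux (cdf D) \<beta> v \<in> O(R)" for v
      using G[of v] H[of v] by (simp_all only: R_def[abs_def])
    obtain C1 where 1: "0 < C1" "\<forall>\<^sub>F n in sequentially. \<bar>G_aux (cdf D) \<alpha> t n\<bar> \<le> C1 * R n"
      using big[OF GR(1)[of t]] by (elim exE conjE) (rule that)
    obtain C2 where 2: "0 < C2" "\<forall>\<^sub>F n in sequentially. \<bar>G_aux (cdf D) \<alpha> (- t) n\<bar> \<le> C2 * R n"
      using big[OF GR(1)[of "- t"]] by (elim exE conjE) (rule that)
    obtain C3 where 3: "0 < C3" "\<forall>\<^sub>F n in sequentially. \<bar>H_aux (cdf D) \<beta> t n\<bar> \<le> C3 * R n"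
      using big[OF GR(2)[of t]] by (elim exE conjE) (rule that)
    obtain C4 where 4: "0 < C4" "\<forall>\<^sub>F n in sequentially. \<bar>H_aux (cdf D) \<beta> (- t) n\<bar> \<le> C4 * R n"
      using big[OF GR(2)[of "- t"]] by (elim exE conjE) (rule that)
    define C where "C = C1 + C2 + C3 + C4"
    have le: "x \<le> C * R n" if "x \<le> C' * R n" "C' \<le> C" for x C' n
      using that mult_right_mono[OF that(2) R0[of n]] by linarith
    have "\<forall>\<^sub>F n in sequentially.
      \<bar>G_aux (cdf D) \<alpha> t n\<bar> \<le> C * R n \<and> \<bar>G_aux (cdf D) \<alpha> (- t) n\<bar> \<le> C * R n \<and>
      \<bar>H_aux (cdf D) \<beta> t n\<bar> \<le> C * R n \<and> \<bar>H_aux (cdf D) \<beta> (- t) n\<bar> \<le> C * R n"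
      using 1(2) 2(2) 3(2) 4(2)
      by eventually_elim (intro conjI; erule le; use 1(1) 2(1) 3(1) 4(1) in \<open>simp add: C_def\<close>)
    then show ?thesis using 1(1) 2(1) 3(1) 4(1) by (intro that[of C]) (auto simp: C_def)
  qed
  define a where "a n = q (\<alpha> n)" for n
  define b where "b n = q (1 - \<beta> n)" for n
  define e where "e n = expectation (\<lambda>\<omega>. winsorize (a n) (b n) (X 1 \<omega>))" for n
  define Y where "Y n i \<omega> = g * (winsorize (a n) (b n) (X i \<omega>) - e n) / \<sigma> n" for n i \<omega>
  define V where "V n \<omega> = g * (sqrt (real n) *
        (trimmed_mean X (k n) (m n) n \<omega> - trimmed_center (cdf D) (\<alpha> n) (\<beta> n)) / \<sigma> n)" for n \<omega>
  define K where "K = \<bar>q (1 - \<kappa>) - q \<kappa>\<bar> / \<sigma>0"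
  \<comment> \<open>The gaps contribute \<open>4 * C * t / \<sigma>0\<close>: two gaps, each with
    two quantile increments of size at most \<open>C * R n\<close>. The additional 1 makes the final
    comparison strict.\<close>
  define d where "d n = (4 * C * t / \<sigma>0 + 1) * (sqrt (ln (real n)) * R n)" for n
  \<comment> \<open>Four Hoeffding events for each of the two gaps.\<close>
  define p where "p n = 8 * real n powr (- (2 * t ^ 2 * \<kappa>))" for n
  have small: "\<forall>\<^sub>F n in sequentially. t * sqrt (ln (real n) / real n) < \<kappa>"
  proof (rule order_tendstoD)
    show "(\<lambda>n. t * sqrt (ln (real n) / real n)) \<longlonglongrightarrow> 0" by real_asymp
  qed (rule \<kappa>)
  have range: "0 < \<alpha> n \<and> \<alpha> n < 1 - \<beta> n \<and> 0 < \<beta> n \<and> \<alpha> n \<le> 1 \<and> \<beta> n \<le> 1"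
    if "1 \<le> n" "\<kappa> \<le> \<alpha> n" "\<kappa> \<le> \<beta> n" for n
  proof -
    have "\<alpha> n + \<beta> n = real (k n + m n) / real n" by (simp add: \<alpha> \<beta> add_divide_distrib)
    also have "\<dots> < 1" using trim[OF that(1)] that(1) by simp
    finally show ?thesis using that \<kappa>(1) by auto
  qed
  have "unif_rel_equiv (\<lambda>n x. prob {\<omega>\<in>space M. V n \<omega> > x}) (\<lambda>n. normal_tail) (\<lambda>n. {- A..c * sqrt (ln (real n))})"
  proof (rule moderate_deviations_perturbed[where Y = Y and V = V and d = d and p = p and K = K, OF c])
    show "0 \<le> K" using \<sigma>0 by (simp add: K_def)
    show "random_variable borel (V n)" for n
      unfolding V_def
      by (intro borel_measurable_times borel_measurable_divide borel_measurable_diff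
          trimmed_mean_measurable borel_measurable_const)
    show "0 \<le> d n" for n
    proof -
      have "0 \<le> ln (real n)" by (cases "n = 0") auto
      then show ?thesis using C(1) t(1) \<sigma>0(1) by (simp add: d_def R_def)
    qed
    show "0 \<le> p n" for n by (simp add: p_def)
    show "\<forall>\<^sub>F n in sequentially. indep_vars (\<lambda>_. borel) (Y n) {1..n} \<and>
        (\<forall>i\<in>{1..n}. distr M borel (Y n i) = distr M borel (Y n 1)) \<and>
        (AE \<omega> in M. \<bar>Y n 1 \<omega>\<bar> \<le> K) \<and>
        expectation (Y n 1) = 0 \<and> expectation (\<lambda>\<omega>. Y n 1 \<omega> ^ 2) = 1"
      using \<kappa>(2,3) \<sigma>0(2) eventually_ge_at_top[of 1]
    proof eventually_elim
      case (elim n)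
      note r = range[OF elim(4,1,2)]
      have ab: "a n \<le> b n"
        unfolding a_def b_def q_def using r by (intro quantile_mono D.real_distribution_axioms) auto
      have "q \<kappa> \<le> a n" "b n \<le> q (1 - \<kappa>)"
        unfolding a_def b_def q_def using r elim \<kappa>(1) by (auto intro!: quantile_mono D.real_distribution_axioms)
      then have "(b n - a n) / \<sigma> n \<le> K"
        unfolding K_def using \<sigma>0(1) elim(3) ab by (intro frac_le) auto
      have sd: "\<sigma> n = sqrt (variance (\<lambda>\<omega>. winsorize (a n) (b n) (X 1 \<omega>)))"
        by (simp only: \<sigma> winsorized_sd_def a_def b_def q_def)
      have "0 < \<sigma> n" using \<sigma>0(1) elim(3) by simp
      note Y = winsorized_standardized[OF ab sd this g e_def[of n] Y_def[of n]]
      show ?case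
        by (intro conjI ballI AE_I2 Y(1,2,4,5) order_trans[OF Y(3) \<open>(b n - a n) / \<sigma> n \<le> K\<close>]) simp
    qed
    show "\<forall>\<^sub>F n in sequentially. \<exists>E\<in>events. prob E \<le> p n \<and>
          (\<forall>\<omega>\<in>space M - E. \<bar>V n \<omega> - (\<Sum>i=1..n. Y n i \<omega>) / sqrt (real n)\<bar> < d n)"
      using \<kappa>(2,3) \<sigma>0(2) small C(2) eventually_ge_at_top[of 3]
    proof eventually_elim
      case (elim n)
      have n: "1 \<le> n" "0 < real n" using elim(6) by auto
      have ln: "0 < ln (real n)" using elim(6) by simp
      note r = range[OF n(1) elim(1,2)]
      \<comment> \<open>Exactly the increment in \<open>G_aux\<close> and \<open>H_aux\<close>, so
        the smoothness assumption at \<open>t\<close> and \<open>- t\<close> controls the quantile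
        increments of the concentration lemma.\<close>
      define u where "u x = t * sqrt (x * ln (real n) / real n)" for x
      have u: "0 < u x" "u x \<le> t * sqrt (ln (real n) / real n)" "u x < \<kappa>"
        and expu: "exp (- 2 * real n * u x ^ 2) \<le> real n powr (- (2 * t ^ 2 * \<kappa>))"
        if x: "\<kappa> \<le> x" "x \<le> 1" for x
      proof -
        have x0: "0 < x" using x \<kappa>(1) by simp
        show "0 < u x" unfolding u_def using t(1) x0 ln n by simp
        have "x * ln (real n) / real n \<le> ln (real n) / real n"
          using x x0 ln n by (intro divide_right_mono) (auto intro: mult_left_le_one_le)
        then show "u x \<le> t * sqrt (ln (real n) / real n)"
          unfolding u_def using t(1) by (intro mult_left_mono) auto
        then show "u x < \<kappa>" using elim(4) by simp
        have "real n * u x ^ 2 = t ^ 2 * (x * ln (real n))"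
          unfolding u_def using x0 ln n by (simp add: power_mult_distrib)
        moreover have "t ^ 2 * (\<kappa> * ln (real n)) \<le> t ^ 2 * (x * ln (real n))"
          using x ln by (intro mult_left_mono mult_right_mono) auto
        ultimately have "- 2 * (real n * u x ^ 2) \<le> - (2 * t ^ 2 * \<kappa>) * ln (real n)"
          by (simp add: mult_ac)
        then show "exp (- 2 * real n * u x ^ 2) \<le> real n powr (- (2 * t ^ 2 * \<kappa>))"
          unfolding powr_def using n by (simp add: mult_ac)
      qed
      note ua = u[OF elim(1), OF r[THEN conjunct2, THEN conjunct2, THEN conjunct2, THEN conjunct1]]
      note ub = u[OF elim(2), OF r[THEN conjunct2, THEN conjunct2, THEN conjunct2, THEN conjunct2]]
      have km: "k n + m n < n" using trim n by simp
      have k: "1 \<le> k n" "k n \<le> n" "real (k n) = real n * \<alpha> n"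
        using r n km by (auto simp: \<alpha> Suc_le_eq zero_less_divide_iff)
      \<comment> \<open>The upper end uses rank \<open>n - m n\<close> and level
        \<open>1 - \<beta> n\<close>, but the step is computed from \<open>\<beta> n\<close>, as in
        \<open>H_aux\<close>; the concentration lemma leaves the step free.\<close>
      have m: "1 \<le> n - m n" "n - m n \<le> n" "real (n - m n) = real n * (1 - \<beta> n)"
        using km n by (auto simp: \<beta> algebra_simps of_nat_diff)
      obtain E1 where E1: "E1 \<in> events" "prob E1 \<le> 4 * exp (- 2 * real n * u (\<alpha> n) ^ 2)"
        "\<And>\<omega>. \<omega> \<in> space M - E1 \<Longrightarrow> \<bar>trimming_gap X n (k n) (a n) \<omega>\<bar> \<le>
          real n * u (\<alpha> n) * (\<bar>q (\<alpha> n + u (\<alpha> n)) - q (\<alpha> n)\<bar> + \<bar>q (\<alpha> n - u (\<alpha> n)) - q (\<alpha> n)\<bar>)"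
        using trimming_gap_concentration[OF k ua(1)] ua(3) r elim(1,2) unfolding q_def a_def by force
      obtain E2 where E2: "E2 \<in> events" "prob E2 \<le> 4 * exp (- 2 * real n * u (\<beta> n) ^ 2)"
        "\<And>\<omega>. \<omega> \<in> space M - E2 \<Longrightarrow> \<bar>trimming_gap X n (n - m n) (b n) \<omega>\<bar> \<le>
          real n * u (\<beta> n) * (\<bar>q (1 - \<beta> n + u (\<beta> n)) - q (1 - \<beta> n)\<bar> + \<bar>q (1 - \<beta> n - u (\<beta> n)) - q (1 - \<beta> n)\<bar>)"
        using trimming_gap_concentration[OF m ub(1)] ub(3) r elim(1,2) unfolding q_def b_def by force
      define B where "B = real n * (t * sqrt (ln (real n) / real n)) * (C * R n + C * R n)"
      have gap: "real n * v * (x + y) \<le> B" if "0 < v" "v \<le> t * sqrt (ln (real n) / real n)"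
        "0 \<le> x" "x \<le> C * R n" "0 \<le> y" "y \<le> C * R n" for v x y
        unfolding B_def using that by (intro mult_mono add_mono) auto
      have aux: "\<bar>q (\<alpha> n + u (\<alpha> n)) - q (\<alpha> n)\<bar> \<le> C * R n" "\<bar>q (\<alpha> n - u (\<alpha> n)) - q (\<alpha> n)\<bar> \<le> C * R n"
        "\<bar>q (1 - \<beta> n + u (\<beta> n)) - q (1 - \<beta> n)\<bar> \<le> C * R n" "\<bar>q (1 - \<beta> n - u (\<beta> n)) - q (1 - \<beta> n)\<bar> \<le> C * R n"
        using elim(5) unfolding G_aux_def H_aux_def q_def u_def by auto
      show ?case
      proof (intro bexI[of _ "E1 \<union> E2"] conjI ballI)
        show "E1 \<union> E2 \<in> events" using E1 E2 by auto
        have "prob (E1 \<union> E2) \<le> prob E1 + prob E2" using E1 E2 by (intro measure_Un_le)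
        also have "\<dots> \<le> p n"
          using E1(2) E2(2) expu[of "\<alpha> n"] expu[of "\<beta> n"] r elim(1,2) unfolding p_def by linarith
        finally show "prob (E1 \<union> E2) \<le> p n" .
        fix \<omega> assume \<omega>: "\<omega> \<in> space M - (E1 \<union> E2)"
        define \<Delta> where "\<Delta> = trimming_gap X n (n - m n) (b n) \<omega> - trimming_gap X n (k n) (a n) \<omega>"
        have "\<bar>trimming_gap X n (k n) (a n) \<omega>\<bar> \<le> B"
          using \<omega> by (intro order_trans[OF E1(3) gap] ua aux) auto
        moreover have "\<bar>trimming_gap X n (n - m n) (b n) \<omega>\<bar> \<le> B"
          using \<omega> by (intro order_trans[OF E2(3) gap] ub aux) auto
        ultimately have \<Delta>: "\<bar>\<Delta>\<bar> \<le> 2 * B" unfolding \<Delta>_def by linarith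
        have sn: "sqrt (real n) * sqrt (real n) = real n" "0 < sqrt (real n)" using n by simp_all
        define \<Theta> where "\<Theta> = trimmed_mean X (k n) (m n) n \<omega> - trimmed_center (cdf D) (\<alpha> n) (\<beta> n)"
        have \<Theta>: "real n * \<Theta> = (\<Sum>j=1..n. winsorize (a n) (b n) (X j \<omega>) - e n) + \<Delta>"
          unfolding \<Theta>_def \<Delta>_def using r
          by (intro trimmed_mean_error km \<alpha> \<beta> e_def) (auto simp: a_def b_def q_def)
        have \<sigma>n: "0 < \<sigma> n" using \<sigma>0(1) elim(3) by simp
        have "V n \<omega> - (\<Sum>i=1..n. Y n i \<omega>) / sqrt (real n) =
            g * (real n * \<Theta> - (\<Sum>j=1..n. winsorize (a n) (b n) (X j \<omega>) - e n)) / (\<sigma> n * sqrt (real n))"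
        proof -
          have "g * (r * \<Theta> / \<sigma> n) = g * (r * r * \<Theta>) / (\<sigma> n * r)" if "0 < r" for r
            using that \<sigma>n by (simp add: field_simps)
          from this[OF sn(2)] have "V n \<omega> = g * (real n * \<Theta>) / (\<sigma> n * sqrt (real n))"
            unfolding V_def \<Theta>_def[symmetric] sn(1) .
          moreover have "(\<Sum>i=1..n. Y n i \<omega>) / sqrt (real n) =
              g * (\<Sum>j=1..n. winsorize (a n) (b n) (X j \<omega>) - e n) / (\<sigma> n * sqrt (real n))"
            unfolding Y_def by (simp only: sum_divide_distrib[symmetric] sum_distrib_left[symmetric] divide_divide_eq_left)
          ultimately show ?thesis by (simp only: right_diff_distrib diff_divide_distrib)
        qed
        also have "\<dots> = g * \<Delta> / (\<sigma> n * sqrt (real n))" unfolding \<Theta> by simp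
        finally have "\<bar>V n \<omega> - (\<Sum>i=1..n. Y n i \<omega>) / sqrt (real n)\<bar> = \<bar>\<Delta>\<bar> / (\<sigma> n * sqrt (real n))"
          using g \<sigma>n by (simp add: abs_mult)
        also have "\<dots> \<le> 2 * B / (\<sigma>0 * sqrt (real n))"
          using \<Delta> \<sigma>0(1) elim(3) sn(2) by (intro frac_le mult_right_mono mult_pos_pos) auto
        also have "\<dots> = 4 * C * t / \<sigma>0 * (sqrt (ln (real n)) * R n)"
        proof -
          have "2 * (r * r * (t * (x / r)) * (C * y + C * y)) / (\<sigma>0 * r) = 4 * C * t / \<sigma>0 * (x * y)"
            if "0 < r" for r x y
            using that \<sigma>0(1) by (simp add: field_simps)
          from this[OF sn(2)] show ?thesis unfolding B_def real_sqrt_divide sn(1) .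
        qed
        also have "\<dots> < d n" unfolding d_def using ln by (simp add: R_def distrib_right)
        finally show "\<bar>V n \<omega> - (\<Sum>i=1..n. Y n i \<omega>) / sqrt (real n)\<bar> < d n" .
      qed
    qed
    \<comment> \<open>The product is of order (ln n)^(-\<epsilon>): the two square roots cancel one
      full power in \<open>R n\<close>, and this is where the smoothness exponent must exceed
      1.\<close>
    show "(\<lambda>n. d n * sqrt (ln (real n))) \<longlonglongrightarrow> 0"
      unfolding d_def R_def using \<epsilon> by real_asymp
    have "- (2 * t ^ 2 * \<kappa>) + Q < 0" using t by simp
    then have "(\<lambda>n. 8 * real n powr (- (2 * t ^ 2 * \<kappa>) + Q)) \<longlonglongrightarrow> 8 * 0"
      by (intro tendsto_mult tendsto_const tendsto_neg_powr filterlim_real_sequentially)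
    then show "(\<lambda>n. p n * real n powr (c ^ 2 / 2 + 1)) \<longlonglongrightarrow> 0"
      unfolding p_def Q_def[symmetric] powr_add by (simp add: mult.assoc)
  qed
  then show ?thesis unfolding V_def .
qed

theorem theorem1p3:
  fixes M :: "'a measure" and X :: "nat \<Rightarrow> 'a \<Rightarrow> real" and F :: "real \<Rightarrow> real"
    and k m :: "nat \<Rightarrow> nat" and \<alpha> \<beta> \<mu> \<sigma>W :: "nat \<Rightarrow> real" and T :: "nat \<Rightarrow> 'a \<Rightarrow> real"
  assumes "prob_space M"
    and indep: "prob_space.indep_vars M (\<lambda>_. borel) X {1..}"
    and ident: "\<And>i. i \<ge> 1 \<Longrightarrow> distr M borel (X i) = distr M borel (X 1)"
    and F: "F = cdf (distr M borel (X 1))"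
    and trim: "\<And>n. n \<ge> 1 \<Longrightarrow> k n + m n < n"
    and trim_inf: "filterlim (\<lambda>n. min (k n) (m n)) at_top sequentially"
    and \<alpha>: "\<And>n. \<alpha> n = real (k n) / real n"
    and \<beta>: "\<And>n. \<beta> n = real (m n) / real n"
    and T: "\<And>n. T n = trimmed_mean X (k n) (m n) n"
    and \<mu>: "\<And>n. \<mu> n = trimmed_center F (\<alpha> n) (\<beta> n)"
    and \<sigma>W: "\<And>n. \<sigma>W n = winsorized_sd M (X 1) F (\<alpha> n) (\<beta> n)"
    and \<sigma>W_pos: "0 < liminf (\<lambda>n. ereal (\<sigma>W n))"
    and \<alpha>_pos: "0 < liminf (\<lambda>n. ereal (\<alpha> n))"
    and \<beta>_pos: "limsup (\<lambda>n. ereal (1 - \<beta> n)) < 1"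
    and \<alpha>_\<beta>: "limsup (\<lambda>n. ereal (\<alpha> n)) < liminf (\<lambda>n. ereal (1 - \<beta> n))"
    and smooth: "\<exists>\<epsilon>>0. \<forall>t.
          G_aux F \<alpha> t \<in> O(\<lambda>n. ln (real n) powr (- (1 + \<epsilon>))) \<and>
          H_aux F \<beta> t \<in> O(\<lambda>n. ln (real n) powr (- (1 + \<epsilon>)))"
  shows "\<forall>c>0. \<forall>A>0.
           unif_rel_equiv
             (\<lambda>n x. measure M {\<omega> \<in> space M. sqrt (real n) * (T n \<omega> - \<mu> n) / \<sigma>W n > x})
             (\<lambda>n x. 1 - std_normal_cdf x)
             (\<lambda>n. {- A..c * sqrt (ln (real n))}) \<and>
           unif_rel_equiv
             (\<lambda>n x. measure M {\<omega> \<in> space M. sqrt (real n) * (T n \<omega> - \<mu> n) / \<sigma>W n < - x})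
             (\<lambda>n x. std_normal_cdf (- x))
             (\<lambda>n. {- A..c * sqrt (ln (real n))})"
proof (intro allI impI)
  fix c A :: real assume c: "0 < c"
  define D where "D = distr M borel (X 1)"
  interpret iid_sample M X D
    by (rule iid_sample.intro[OF assms(1)], rule iid_sample_axioms.intro)
      (rule indep, unfold D_def, rule ident)
  obtain \<epsilon> where \<epsilon>: "0 < \<epsilon>" "\<And>t. G_aux (cdf D) \<alpha> t \<in> O(\<lambda>n. ln (real n) powr (- (1 + \<epsilon>)))"
    "\<And>t. H_aux (cdf D) \<beta> t \<in> O(\<lambda>n. ln (real n) powr (- (1 + \<epsilon>)))"
    using smooth unfolding F D_def[symmetric] by blast
  \<comment> \<open>A real number strictly below the lower limit turns it into an eventual bound;
    the two trimming proportions are treated likewise.\<close>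
  obtain \<sigma>0 where \<sigma>0': "0 < ereal \<sigma>0" "ereal \<sigma>0 < liminf (\<lambda>n. ereal (\<sigma>W n))"
    using ereal_dense2[OF \<sigma>W_pos] by (elim exE conjE) (rule that)
  have \<sigma>0: "0 < \<sigma>0" "\<forall>\<^sub>F n in sequentially. \<sigma>0 \<le> \<sigma>W n"
    using \<sigma>0'(1) eventually_mono[OF less_LiminfD[OF \<sigma>0'(2)]] by simp_all
  obtain \<kappa>1 where \<kappa>1': "0 < ereal \<kappa>1" "ereal \<kappa>1 < liminf (\<lambda>n. ereal (\<alpha> n))"
    using ereal_dense2[OF \<alpha>_pos] by (elim exE conjE) (rule that)
  have \<kappa>1: "0 < \<kappa>1" "\<forall>\<^sub>F n in sequentially. \<kappa>1 \<le> \<alpha> n"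
    using \<kappa>1'(1) eventually_mono[OF less_LiminfD[OF \<kappa>1'(2)]] by simp_all
  obtain \<kappa>2 where \<kappa>2': "limsup (\<lambda>n. ereal (1 - \<beta> n)) < ereal \<kappa>2" "ereal \<kappa>2 < 1"
    using ereal_dense2[OF \<beta>_pos] by (elim exE conjE) (rule that)
  have \<kappa>2: "\<kappa>2 < 1" "\<forall>\<^sub>F n in sequentially. 1 - \<beta> n \<le> \<kappa>2"
    using \<kappa>2'(2) eventually_mono[OF Limsup_lessD[OF \<kappa>2'(1)]] by simp_all
  \<comment> \<open>An eventual upper bound \<kappa>2 for \<open>1 - \<beta> n\<close> is a lower
    bound \<open>1 - \<kappa>2\<close> for \<open>\<beta> n\<close>.\<close>
  define \<kappa> where "\<kappa> = min \<kappa>1 (1 - \<kappa>2)"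
  have \<kappa>: "0 < \<kappa>" "\<forall>\<^sub>F n in sequentially. \<kappa> \<le> \<alpha> n" "\<forall>\<^sub>F n in sequentially. \<kappa> \<le> \<beta> n"
    using \<kappa>1 \<kappa>2 eventually_mono[OF \<kappa>1(2), of "\<lambda>n. \<kappa> \<le> \<alpha> n"] eventually_mono[OF \<kappa>2(2), of "\<lambda>n. \<kappa> \<le> \<beta> n"]
    by (auto simp: \<kappa>_def)
  note tail = trimmed_mean_tail[OF trim \<alpha> \<beta> \<sigma>W[unfolded F, folded D_def] \<kappa> \<sigma>0 \<epsilon> _ c]
  \<comment> \<open>The lower tail is the upper tail of the negated statistic, that is the case
    \<open>g = - 1\<close>; by symmetry of the Gaussian law both tails have the same limit
    \<open>normal_tail\<close>.\<close>
  have flip: "x < - y \<longleftrightarrow> y < - x" for x y :: real by linarith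
  show "unif_rel_equiv
             (\<lambda>n x. measure M {\<omega> \<in> space M. sqrt (real n) * (T n \<omega> - \<mu> n) / \<sigma>W n > x})
             (\<lambda>n x. 1 - std_normal_cdf x)
             (\<lambda>n. {- A..c * sqrt (ln (real n))}) \<and>
           unif_rel_equiv
             (\<lambda>n x. measure M {\<omega> \<in> space M. sqrt (real n) * (T n \<omega> - \<mu> n) / \<sigma>W n < - x})
             (\<lambda>n x. std_normal_cdf (- x))
             (\<lambda>n. {- A..c * sqrt (ln (real n))})"
    using tail[of 1 A] tail[of "- 1" A]
    unfolding T \<mu> F D_def[symmetric] normal_tail_eq[symmetric] std_normal_cdf_minus flip by simp
qed

end
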